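(* Let $K(z,w)=\sum_{n=0}^\infty b_n(z\bar w)^n$, $b_n>0$, be a positive definite kernel on $\mathbb D\times\mathbb D$. Suppose that $b_n\sim(n+1)^\gamma$ for some $\gamma\in\mathbb R$. Then the multiplication operator $M_z$ on $(\mathcal H,K)$ is Möbius bounded if and only if $\gamma>-1$. In particular, the multiplication operator $M_z$ on the Dirichlet space is not Möbius bounded.
   Context: $\mathbb D$ is the open unit disc; Möb is the group of all biholomorphic automorphisms of $\mathbb D$. A bounded operator $T$ is Möbius bounded if $\sigma(T)\subseteq\overline{\mathbb D}$ and $\sup_{\varphi\in\text{Möb}}\|\varphi(T)\|<\infty$, where $\varphi(T)$ is defined by the holomorphic functional calculus. $(\mathcal H,K)$ is the reproducing kernel Hilbert space of holomorphic functions on $\mathbb D$ with kernel $K$, and $M_z$ is multiplication by the coordinate function $z$. For sequences of positive reals, $a_n\sim b_n$ means that there are constants $c_1,c_2>0$ with $c_1b_n\leq a_n\leq c_2b_n$ for all $n\geq 0$. The Dirichlet space is $(\mathcal H,K_{(-1)})$ with $K_{(-1)}(z,w)=\sum_{n=0}^\infty\frac{1}{n+1}(z\bar w)^n$. *)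

theory Defs
  imports "HOL-Complex_Analysis.Complex_Analysis"
begin

section \<open>Hilbert spaces of functions and their operators\<close>

text \<open>
  A complex Hilbert space of functions is given by its carrier \<open>H\<close> and an inner product \<open>ip\<close>,
  linear in the first argument. Nothing is said about \<open>ip\<close> and about operators off \<open>H\<close>.
\<close>

definition ip_norm :: "(('x \<Rightarrow> complex) \<Rightarrow> ('x \<Rightarrow> complex) \<Rightarrow> complex) \<Rightarrow> ('x \<Rightarrow> complex) \<Rightarrow> real" where
  "ip_norm ip f = sqrt (Re (ip f f))"

locale function_hilbert_space =
  fixes H :: "('x \<Rightarrow> complex) set"
    and ip :: "('x \<Rightarrow> complex) \<Rightarrow> ('x \<Rightarrow> complex) \<Rightarrow> complex"
  assumes zero_mem: "(\<lambda>x. 0) \<in> H"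
    and add_mem: "\<lbrakk>f \<in> H; g \<in> H\<rbrakk> \<Longrightarrow> (\<lambda>x. f x + g x) \<in> H"
    and scale_mem: "f \<in> H \<Longrightarrow> (\<lambda>x. c * f x) \<in> H"
    and ip_add: "\<lbrakk>f \<in> H; g \<in> H; h \<in> H\<rbrakk> \<Longrightarrow> ip (\<lambda>x. f x + g x) h = ip f h + ip g h"
    and ip_scale: "\<lbrakk>f \<in> H; h \<in> H\<rbrakk> \<Longrightarrow> ip (\<lambda>x. c * f x) h = c * ip f h"
    and ip_cnj: "\<lbrakk>f \<in> H; h \<in> H\<rbrakk> \<Longrightarrow> ip h f = cnj (ip f h)"
    and ip_pos: "\<lbrakk>f \<in> H; f \<noteq> (\<lambda>x. 0)\<rbrakk> \<Longrightarrow> Re (ip f f) > 0"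
    and complete:
      "\<lbrakk>\<And>n::nat. X n \<in> H;
        \<And>e. e > 0 \<Longrightarrow> \<exists>N. \<forall>m\<ge>N. \<forall>n\<ge>N. ip_norm ip (\<lambda>x. X m x - X n x) < e\<rbrakk>
       \<Longrightarrow> \<exists>L\<in>H. (\<lambda>n. ip_norm ip (\<lambda>x. X n x - L x)) \<longlonglongrightarrow> 0"

definition bounded_op ::
  "('x \<Rightarrow> complex) set \<Rightarrow> (('x \<Rightarrow> complex) \<Rightarrow> ('x \<Rightarrow> complex) \<Rightarrow> complex) \<Rightarrow>
   (('x \<Rightarrow> complex) \<Rightarrow> ('x \<Rightarrow> complex)) \<Rightarrow> bool" where
  "bounded_op H ip T \<longleftrightarrow>
     (\<forall>f\<in>H. T f \<in> H) \<and>
     (\<forall>f\<in>H. \<forall>g\<in>H. T (\<lambda>x. f x + g x) = (\<lambda>x. T f x + T g x)) \<and>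
     (\<forall>c. \<forall>f\<in>H. T (\<lambda>x. c * f x) = (\<lambda>x. c * T f x)) \<and>
     (\<exists>C. \<forall>f\<in>H. ip_norm ip (T f) \<le> C * ip_norm ip f)"

definition op_norm ::
  "('x \<Rightarrow> complex) set \<Rightarrow> (('x \<Rightarrow> complex) \<Rightarrow> ('x \<Rightarrow> complex) \<Rightarrow> complex) \<Rightarrow>
   (('x \<Rightarrow> complex) \<Rightarrow> ('x \<Rightarrow> complex)) \<Rightarrow> real" where
  "op_norm H ip T = (SUP f \<in> {f \<in> H. ip_norm ip f \<le> 1}. ip_norm ip (T f))"

definition resolvent ::
  "('x \<Rightarrow> complex) set \<Rightarrow> (('x \<Rightarrow> complex) \<Rightarrow> ('x \<Rightarrow> complex)) \<Rightarrow> complex \<Rightarrow>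
   ('x \<Rightarrow> complex) \<Rightarrow> ('x \<Rightarrow> complex)" where
  "resolvent H T c = inv_into H (\<lambda>f x. c * f x - T f x)"

definition op_spectrum ::
  "('x \<Rightarrow> complex) set \<Rightarrow> (('x \<Rightarrow> complex) \<Rightarrow> ('x \<Rightarrow> complex) \<Rightarrow> complex) \<Rightarrow>
   (('x \<Rightarrow> complex) \<Rightarrow> ('x \<Rightarrow> complex)) \<Rightarrow> complex set" where
  "op_spectrum H ip T =
     {c. \<not> (bij_betw (\<lambda>f x. c * f x - T f x) H H \<and> bounded_op H ip (resolvent H T c))}"

text \<open>
  The operator \<open>S\<close> is \<open>f(T)\<close> in the sense of the holomorphic (Riesz--Dunford) functional calculus,
  for \<open>f\<close> holomorphic on the open set \<open>U\<close> containing the spectrum: \<open>S\<close> is the integral of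
  \<open>f(c) (c - T)\<^sup>-\<^sup>1 / (2 \<pi> \<i>)\<close> over a cycle (a list of closed paths) in \<open>U\<close> minus the spectrum
  that winds once around each point of the spectrum and does not wind around any point off \<open>U\<close>.
  The resolvent is norm continuous on such a cycle, so that the operator-valued integral is
  determined by its matrix coefficients. By Cauchy's theorem \<open>S\<close> does not depend on the cycle.
\<close>

definition holomorphic_calculus ::
  "('x \<Rightarrow> complex) set \<Rightarrow> (('x \<Rightarrow> complex) \<Rightarrow> ('x \<Rightarrow> complex) \<Rightarrow> complex) \<Rightarrow>
   (('x \<Rightarrow> complex) \<Rightarrow> ('x \<Rightarrow> complex)) \<Rightarrow> complex set \<Rightarrow> (complex \<Rightarrow> complex) \<Rightarrow>
   (('x \<Rightarrow> complex) \<Rightarrow> ('x \<Rightarrow> complex)) \<Rightarrow> bool" where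
  "holomorphic_calculus H ip T U f S \<longleftrightarrow>
     open U \<and> op_spectrum H ip T \<subseteq> U \<and> f holomorphic_on U \<and> bounded_op H ip S \<and>
     (\<exists>\<Gamma>. (\<forall>\<gamma>\<in>set \<Gamma>. valid_path \<gamma> \<and> pathfinish \<gamma> = pathstart \<gamma> \<and>
                    path_image \<gamma> \<subseteq> U - op_spectrum H ip T) \<and>
          (\<forall>c\<in>op_spectrum H ip T. (\<Sum>\<gamma>\<leftarrow>\<Gamma>. winding_number \<gamma> c) = 1) \<and>
          (\<forall>c. c \<notin> U \<longrightarrow> (\<Sum>\<gamma>\<leftarrow>\<Gamma>. winding_number \<gamma> c) = 0) \<and>
          (\<forall>g\<in>H. \<forall>h\<in>H.
             ip (S g) h =
               1 / (2 * of_real pi * \<i>) *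
               (\<Sum>\<gamma>\<leftarrow>\<Gamma>. contour_integral \<gamma> (\<lambda>c. f c * ip (resolvent H T c g) h))))"

section \<open>Moebius bounded operators\<close>

abbreviation unit_disc :: "complex set" where
  "unit_disc \<equiv> ball 0 1"

definition Moeb :: "(complex \<Rightarrow> complex) set" where
  "Moeb = {\<phi>. bij_betw \<phi> unit_disc unit_disc \<and> \<phi> holomorphic_on unit_disc \<and>
              inv_into unit_disc \<phi> holomorphic_on unit_disc}"

text \<open>
  Elements of \<open>Moeb\<close> matter on the open disc only, whereas the spectrum of \<open>T\<close> may meet the unit
  circle. Each of them extends holomorphically to a domain \<open>U\<close> containing the closed disc (uniquely,
  as \<open>U\<close> is connected), and \<open>\<phi>(T)\<close> is formed with such an extension \<open>\<psi>\<close>.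
\<close>

definition Moeb_calculus ::
  "('x \<Rightarrow> complex) set \<Rightarrow> (('x \<Rightarrow> complex) \<Rightarrow> ('x \<Rightarrow> complex) \<Rightarrow> complex) \<Rightarrow>
   (('x \<Rightarrow> complex) \<Rightarrow> ('x \<Rightarrow> complex)) \<Rightarrow> (complex \<Rightarrow> complex) \<Rightarrow>
   (('x \<Rightarrow> complex) \<Rightarrow> ('x \<Rightarrow> complex)) \<Rightarrow> bool" where
  "Moeb_calculus H ip T \<phi> S \<longleftrightarrow>
     (\<exists>U \<psi>. connected U \<and> cball 0 1 \<subseteq> U \<and> (\<forall>z\<in>unit_disc. \<psi> z = \<phi> z) \<and>
            holomorphic_calculus H ip T U \<psi> S)"

text \<open>
  On \<open>H\<close> there is exactly one \<open>S\<close> with \<open>Moeb_calculus H ip T \<phi> S\<close>, namely \<open>\<phi>(T)\<close>.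
\<close>

definition Moebius_bounded ::
  "('x \<Rightarrow> complex) set \<Rightarrow> (('x \<Rightarrow> complex) \<Rightarrow> ('x \<Rightarrow> complex) \<Rightarrow> complex) \<Rightarrow>
   (('x \<Rightarrow> complex) \<Rightarrow> ('x \<Rightarrow> complex)) \<Rightarrow> bool" where
  "Moebius_bounded H ip T \<longleftrightarrow>
     bounded_op H ip T \<and> op_spectrum H ip T \<subseteq> cball 0 1 \<and>
     (\<exists>C. \<forall>\<phi>\<in>Moeb. \<exists>S. Moeb_calculus H ip T \<phi> S \<and> op_norm H ip S \<le> C)"

section \<open>Reproducing kernel Hilbert spaces on the disc\<close>

definition positive_definite_kernel :: "'x set \<Rightarrow> ('x \<Rightarrow> 'x \<Rightarrow> complex) \<Rightarrow> bool" where
  "positive_definite_kernel D K \<longleftrightarrow>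
     (\<forall>A c. finite A \<and> A \<subseteq> D \<longrightarrow>
        (\<Sum>z\<in>A. \<Sum>w\<in>A. cnj (c z) * c w * K z w) \<in> \<real> \<and>
        Re (\<Sum>z\<in>A. \<Sum>w\<in>A. cnj (c z) * c w * K z w) \<ge> 0)"

text \<open>
  Functions on the disc are represented by functions on the plane that vanish off the disc. By the
  Moore--Aronszajn theorem, \<open>H\<close> and the restriction of \<open>ip\<close> to \<open>H\<close> are determined by \<open>K\<close>.
\<close>

locale disc_rkhs = function_hilbert_space H ip
  for H :: "(complex \<Rightarrow> complex) set"
    and ip :: "(complex \<Rightarrow> complex) \<Rightarrow> (complex \<Rightarrow> complex) \<Rightarrow> complex"
    and K :: "complex \<Rightarrow> complex \<Rightarrow> complex" +
  assumes vanishes: "\<lbrakk>f \<in> H; z \<notin> unit_disc\<rbrakk> \<Longrightarrow> f z = 0"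
    and holomorphic: "f \<in> H \<Longrightarrow> f holomorphic_on unit_disc"
    and kernel_mem: "w \<in> unit_disc \<Longrightarrow> (\<lambda>z. if z \<in> unit_disc then K z w else 0) \<in> H"
    and reproducing:
      "\<lbrakk>f \<in> H; w \<in> unit_disc\<rbrakk> \<Longrightarrow> ip f (\<lambda>z. if z \<in> unit_disc then K z w else 0) = f w"

definition mult_z :: "(complex \<Rightarrow> complex) \<Rightarrow> (complex \<Rightarrow> complex)" where
  "mult_z f = (\<lambda>z. z * f z)"

definition power_kernel :: "(nat \<Rightarrow> real) \<Rightarrow> complex \<Rightarrow> complex \<Rightarrow> complex" where
  "power_kernel b z w = (\<Sum>n. of_real (b n) * (z * cnj w) ^ n)"

definition Dirichlet_kernel :: "complex \<Rightarrow> complex \<Rightarrow> complex" where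
  "Dirichlet_kernel = power_kernel (\<lambda>n. 1 / (real n + 1))"

definition comparable :: "(nat \<Rightarrow> real) \<Rightarrow> (nat \<Rightarrow> real) \<Rightarrow> bool" where
  "comparable a b \<longleftrightarrow> (\<exists>c1 > 0. \<exists>c2 > 0. \<forall>n. c1 * b n \<le> a n \<and> a n \<le> c2 * b n)"

end

theory Submission
  imports Defs "HOL-Real_Asymp.Real_Asymp"
begin

text \<open>
  Let \<open>a n\<close> be the Taylor coefficients of \<open>f\<close> in the space. The reproducing property gives
  \<open>\<parallel>f\<parallel>\<^sup>2 = (\<Sum>n. \<bar>a n\<bar>\<^sup>2 / b n)\<close> (\<open>norm_sums\<close>), and every square summable sequence for these weights
  occurs (\<open>mem_if_summable\<close>). The spectrum of \<open>M\<^sub>z\<close> contains the open disc and lies in the closed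
  one, and for an automorphism \<open>\<phi>\<close> of the disc \<open>\<phi>(M\<^sub>z)\<close> is multiplication by \<open>\<phi>\<close>: the Cauchy
  integral over a circle outside the closed disc yields this operator (\<open>calculus_mult\<close>), and so does
  any other admissible cycle, which is what a lower bound has to take into account
  (\<open>Moeb_calculus_unique\<close>). So the question is whether
  the multiplications by \<open>u (z - a) / (1 - cnj a z)\<close> with \<open>\<bar>u\<bar> = 1\<close>, \<open>\<bar>a\<bar> < 1\<close> are uniformly bounded.

  On coefficients, multiplication is convolution, and the coefficients of the automorphism have the
  absolute values \<open>t, 1 - t\<^sup>2, (1 - t\<^sup>2) t, (1 - t\<^sup>2) t\<^sup>2, \<dots>\<close> with \<open>t = \<bar>a\<bar>\<close>, whose sum is at most \<open>3\<close>
  for every \<open>t\<close>. By Schur's test with the weight \<open>b\<close> itself as test sequence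
  (\<open>weighted_convolution\<close>), uniform boundedness follows once the convolution of these absolute values
  with \<open>(n + 1) powr \<gamma>\<close> is bounded by a multiple of \<open>(n + 1) powr \<gamma>\<close>, uniformly in \<open>t\<close>. For \<open>\<gamma> > -1\<close>
  this is true (\<open>Moebius_weight_Schur\<close>): the terms of low index are controlled by the mean of
  \<open>(n + 1) powr \<gamma>\<close> over \<open>n < m\<close>, which is then of the order \<open>m powr \<gamma>\<close>.

  For \<open>\<gamma> \<le> -1\<close> that mean is too large, and so is the norm: multiplying
  \<open>\<Sum>n\<le>N. z ^ n / (n + 1)\<close> by the automorphism with zero \<open>1 - 1 / (4 N)\<close> increases the square of the
  norm at least by a constant multiple of the harmonic sum \<open>\<Sum>n\<le>N. 1 / (n + 1)\<close> as a factor
  (\<open>norm_ratio_lower_bound\<close>), and this sum tends to infinity. The Dirichlet space is the case \<open>\<gamma> = -1\<close>.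
\<close>

section \<open>Hilbert spaces of functions\<close>

lemma mult_cnj_eq_norm_sq: "z * cnj z = (of_real (norm z))\<^sup>2"
  using complex_norm_square[of z] by simp

context function_hilbert_space
begin

lemma diff_mem: "\<lbrakk>f \<in> H; g \<in> H\<rbrakk> \<Longrightarrow> (\<lambda>x. f x - g x) \<in> H"
  using add_mem[OF _ scale_mem[of g "-1"], of f] by simp

lemma sum_mem: "(\<And>i. i \<in> A \<Longrightarrow> f i \<in> H) \<Longrightarrow> (\<lambda>x. \<Sum>i\<in>A. f i x) \<in> H"
  by (induction A rule: infinite_finite_induct) (auto simp: zero_mem intro: add_mem)

lemma ip_diff: "\<lbrakk>f \<in> H; g \<in> H; h \<in> H\<rbrakk> \<Longrightarrow> ip (\<lambda>x. f x - g x) h = ip f h - ip g h"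
  using ip_add[OF _ scale_mem[of g "-1"], of f h] ip_scale[of g h "-1"] by simp

lemma ip_zero: "h \<in> H \<Longrightarrow> ip (\<lambda>x. 0) h = 0"
  using ip_scale[OF zero_mem, of h 0] by simp

lemma ip_sum:
  "\<lbrakk>\<And>i. i \<in> A \<Longrightarrow> f i \<in> H; h \<in> H\<rbrakk> \<Longrightarrow> ip (\<lambda>x. \<Sum>i\<in>A. f i x) h = (\<Sum>i\<in>A. ip (f i) h)"
  by (induction A rule: infinite_finite_induct) (auto simp: ip_zero ip_add sum_mem)

lemma ip_diff_right: "\<lbrakk>f \<in> H; g \<in> H; h \<in> H\<rbrakk> \<Longrightarrow> ip h (\<lambda>x. f x - g x) = ip h f - ip h g"
  using ip_cnj[of "\<lambda>x. f x - g x" h] ip_cnj[of f h] ip_cnj[of g h]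
  by (simp add: diff_mem ip_diff)

lemma ip_scale_right: "\<lbrakk>f \<in> H; h \<in> H\<rbrakk> \<Longrightarrow> ip h (\<lambda>x. c * f x) = cnj c * ip h f"
  using ip_cnj[of "\<lambda>x. c * f x" h] ip_cnj[of f h] by (simp add: scale_mem ip_scale)

lemma ip_sum_right:
  "\<lbrakk>\<And>i. i \<in> A \<Longrightarrow> f i \<in> H; h \<in> H\<rbrakk> \<Longrightarrow> ip h (\<lambda>x. \<Sum>i\<in>A. f i x) = (\<Sum>i\<in>A. ip h (f i))"
  using ip_cnj[of "\<lambda>x. \<Sum>i\<in>A. f i x" h] ip_cnj[of _ h]
  by (simp add: sum_mem ip_sum)

lemma Re_ip_nonneg: "f \<in> H \<Longrightarrow> Re (ip f f) \<ge> 0"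
  using ip_pos[of f] ip_zero[OF zero_mem] by (cases "f = (\<lambda>x. 0)") auto

lemma ip_norm_sq: "f \<in> H \<Longrightarrow> (ip_norm ip f)\<^sup>2 = Re (ip f f)"
  by (simp add: ip_norm_def Re_ip_nonneg)

lemma ip_self: "f \<in> H \<Longrightarrow> ip f f = of_real ((ip_norm ip f)\<^sup>2)"
  using ip_cnj[of f f] by (simp add: ip_norm_sq complex_eq_iff)

lemma ip_norm_nonneg: "f \<in> H \<Longrightarrow> ip_norm ip f \<ge> 0"
  by (simp add: ip_norm_def Re_ip_nonneg)

lemma ip_norm_zero: "ip_norm ip (\<lambda>x. 0) = 0"
  by (simp add: ip_norm_def ip_zero[OF zero_mem])

lemma ip_norm_pos: "\<lbrakk>f \<in> H; f \<noteq> (\<lambda>x. 0)\<rbrakk> \<Longrightarrow> ip_norm ip f > 0"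
  by (simp add: ip_norm_def ip_pos)

lemma ip_norm_scale: "f \<in> H \<Longrightarrow> ip_norm ip (\<lambda>x. c * f x) = norm c * ip_norm ip f"
proof -
  assume f: "f \<in> H"
  have "ip (\<lambda>x. c * f x) (\<lambda>x. c * f x) = (c * cnj c) * ip f f"
    by (simp add: ip_scale ip_scale_right scale_mem f)
  also have "\<dots> = of_real ((norm c * ip_norm ip f)\<^sup>2)"
    by (simp add: ip_self f mult_cnj_eq_norm_sq power_mult_distrib)
  finally have "Re (ip (\<lambda>x. c * f x) (\<lambda>x. c * f x)) = (norm c * ip_norm ip f)\<^sup>2"
    by (metis Re_complex_of_real)
  then show ?thesis
    using f by (subst ip_norm_def) (simp add: ip_norm_nonneg)
qed

lemma Cauchy_Schwarz_ip:
  assumes f: "f \<in> H" and g: "g \<in> H"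
  shows "norm (ip f g) \<le> ip_norm ip f * ip_norm ip g"
proof (cases "g = (\<lambda>x. 0)")
  case True
  then have "ip f g = 0" using ip_cnj[OF zero_mem f] ip_zero[OF f] by simp
  then show ?thesis using f g by (simp add: ip_norm_nonneg)
next
  case False
  define N where "N = (ip_norm ip g)\<^sup>2"
  have N: "N > 0" using ip_norm_pos[OF g False] by (simp add: N_def)
  define t where "t = ip f g / of_real N"
  let ?tg = "\<lambda>x. t * g x"
  have tg: "?tg \<in> H" using g by (rule scale_mem)
  have gg: "ip g g = of_real N" using g by (simp add: ip_self N_def)
  have "ip (\<lambda>x. f x - ?tg x) (\<lambda>x. f x - ?tg x)
          = ip f f - cnj t * ip f g - t * cnj (ip f g) + t * cnj t * of_real N"
    using f g tg ip_cnj[OF f g] 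
    by (simp add: ip_diff ip_diff_right diff_mem ip_scale ip_scale_right gg algebra_simps)
  also have "t * cnj t * of_real N = cnj t * ip f g"
    using N by (simp add: t_def)
  also have "ip f f - cnj t * ip f g - t * cnj (ip f g) + cnj t * ip f g
      = of_real ((ip_norm ip f)\<^sup>2) - of_real ((norm (ip f g))\<^sup>2 / N)"
    using f by (simp add: ip_self t_def mult_cnj_eq_norm_sq mult.commute)
  finally have "0 \<le> (ip_norm ip f)\<^sup>2 - (norm (ip f g))\<^sup>2 / N"
    using Re_ip_nonneg[OF diff_mem[OF f tg]] by (metis Re_complex_of_real of_real_diff)
  then have "(norm (ip f g))\<^sup>2 \<le> (ip_norm ip f * ip_norm ip g)\<^sup>2"
    using N by (simp add: field_simps N_def power_mult_distrib)
  then show ?thesis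
    using f g by (simp add: ip_norm_nonneg power2_le_iff_abs_le)
qed

lemma tendsto_ip:
  assumes "\<And>n. X n \<in> H" "L \<in> H" "h \<in> H"
    and lim: "(\<lambda>n. ip_norm ip (\<lambda>x. X n x - L x)) \<longlonglongrightarrow> 0"
  shows "(\<lambda>n. ip (X n) h) \<longlonglongrightarrow> ip L h"
proof (rule LIM_zero_cancel, rule Lim_null_comparison)
  show "\<forall>\<^sub>F n in sequentially.
          norm (ip (X n) h - ip L h) \<le> ip_norm ip (\<lambda>x. X n x - L x) * ip_norm ip h"
    using Cauchy_Schwarz_ip[OF diff_mem] assms by (simp flip: ip_diff)
  show "(\<lambda>n. ip_norm ip (\<lambda>x. X n x - L x) * ip_norm ip h) \<longlonglongrightarrow> 0"
    using tendsto_mult_left_zero[OF lim] .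
qed

lemma tendsto_ip_right:
  assumes "\<And>n. X n \<in> H" "L \<in> H" "h \<in> H"
    and lim: "(\<lambda>n. ip_norm ip (\<lambda>x. X n x - L x)) \<longlonglongrightarrow> 0"
  shows "(\<lambda>n. ip h (X n)) \<longlonglongrightarrow> ip h L"
  using tendsto_cnj[OF tendsto_ip[OF assms]] assms ip_cnj[of _ h] by simp

text \<open>
  Completeness in terms of Gram matrices: a sequence converges once its inner products
  \<open>ip (X m) (X n)\<close> have a limit as both indices grow, because
  \<open>\<parallel>X m - X n\<parallel>\<^sup>2\<close> is a combination of four of them with coefficients of sum zero.
\<close>

lemma convergent_if_Gram_convergent:
  assumes X: "\<And>n. X n \<in> H"
    and G: "\<And>e. e > 0 \<Longrightarrow> \<exists>N::nat. \<forall>m\<ge>N. \<forall>n\<ge>N. norm (ip (X m) (X n) - c) < e"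
  obtains L where "L \<in> H" "(\<lambda>n. ip_norm ip (\<lambda>x. X n x - L x)) \<longlonglongrightarrow> 0"
proof -
  have "\<exists>N. \<forall>m\<ge>N. \<forall>n\<ge>N. ip_norm ip (\<lambda>x. X m x - X n x) < e" if e: "e > 0" for e
  proof -
    obtain N where N: "\<And>m n. m \<ge> N \<Longrightarrow> n \<ge> N \<Longrightarrow> norm (ip (X m) (X n) - c) < e\<^sup>2 / 4"
      using G[of "e\<^sup>2 / 4"] e by auto
    have "ip_norm ip (\<lambda>x. X m x - X n x) < e" if mn: "m \<ge> N" "n \<ge> N" for m n
    proof -
      have "ip (\<lambda>x. X m x - X n x) (\<lambda>x. X m x - X n x)
         = (ip (X m) (X m) - c) - (ip (X m) (X n) - c) - ((ip (X n) (X m) - c) - (ip (X n) (X n) - c))"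
        by (simp add: ip_diff ip_diff_right diff_mem X)
      also have "norm \<dots> < e\<^sup>2"
        using N[of m m] N[of m n] N[of n m] N[of n n] mn
          norm_triangle_ineq4[of "ip (X m) (X m) - c" "ip (X m) (X n) - c"]
          norm_triangle_ineq4[of "ip (X n) (X m) - c" "ip (X n) (X n) - c"]
          norm_triangle_ineq4[of "(ip (X m) (X m) - c) - (ip (X m) (X n) - c)"
            "(ip (X n) (X m) - c) - (ip (X n) (X n) - c)"]
        by linarith
      finally have "(ip_norm ip (\<lambda>x. X m x - X n x))\<^sup>2 < e\<^sup>2"
        by (simp add: ip_self diff_mem X norm_power)
      then show ?thesis using e by (simp add: power_less_imp_less_base)
    qed
    then show ?thesis by blast
  qed
  from complete[OF X this] that show ?thesis by blast
qed

text \<open>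
  Boundedness of \<open>S\<close> makes the supremum in \<open>op_norm\<close> one over a set that is bounded above; without
  it the supremum would be an arbitrary real.
\<close>

lemma op_norm_bound:
  assumes S: "bounded_op H ip S" and C: "op_norm H ip S \<le> C" and f: "f \<in> H"
  shows "ip_norm ip (S f) \<le> C * ip_norm ip f"
proof (cases "f = (\<lambda>x. 0)")
  case True
  have "\<forall>c. \<forall>f\<in>H. S (\<lambda>x. c * f x) = (\<lambda>x. c * S f x)"
    using S by (simp add: bounded_op_def)
  from this[rule_format, OF zero_mem, of 0] show ?thesis
    using True by (simp add: ip_norm_zero)
next
  case False
  define r where "r = ip_norm ip f"
  have r: "r > 0" unfolding r_def by (rule ip_norm_pos[OF f False])
  obtain B where B: "\<forall>f\<in>H. ip_norm ip (S f) \<le> B * ip_norm ip f"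
    using S unfolding bounded_op_def by blast
  define e where "e = (\<lambda>x. of_real (1 / r) * f x)"
  have e: "e \<in> H" unfolding e_def by (rule scale_mem[OF f])
  have e1: "ip_norm ip e = 1"
    unfolding e_def ip_norm_scale[OF f] using r by (simp add: r_def norm_divide)
  have Sf: "S f \<in> H" using S f unfolding bounded_op_def by blast
  have "\<forall>c. \<forall>f\<in>H. S (\<lambda>x. c * f x) = (\<lambda>x. c * S f x)"
    using S by (simp add: bounded_op_def)
  from this[rule_format, OF f] have "S e = (\<lambda>x. of_real (1 / r) * S f x)"
    unfolding e_def .
  then have Se: "ip_norm ip (S e) = 1 / r * ip_norm ip (S f)"
    using r ip_norm_scale[OF Sf, of "of_real (1 / r)"] by (simp add: norm_divide)
  have "bdd_above ((\<lambda>f. ip_norm ip (S f)) ` {f \<in> H. ip_norm ip f \<le> 1})"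
  proof (rule bdd_aboveI2)
    fix f assume "f \<in> {f \<in> H. ip_norm ip f \<le> 1}"
    then have f: "f \<in> H" "ip_norm ip f \<le> 1" by auto
    have "ip_norm ip (S f) \<le> B * ip_norm ip f" using B f(1) by blast
    also have "\<dots> \<le> \<bar>B\<bar> * ip_norm ip f"
      using ip_norm_nonneg[OF f(1)] by (intro mult_right_mono) auto
    also have "\<dots> \<le> \<bar>B\<bar> * 1" by (rule mult_left_mono[OF f(2)]) simp
    finally show "ip_norm ip (S f) \<le> \<bar>B\<bar>" by simp
  qed
  then have "ip_norm ip (S e) \<le> op_norm H ip S"
    unfolding op_norm_def by (rule cSUP_upper[rotated]) (use e e1 in simp)
  with C have "1 / r * ip_norm ip (S f) \<le> C" unfolding Se by linarith
  then show ?thesis using r by (simp add: r_def field_simps)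
qed

end

section \<open>Convolution on weighted sequence spaces\<close>

text \<open>
  Schur's test for the lower triangular matrix \<open>g (m - n)\<close>. The columns are controlled by the
  absolute sum of \<open>g\<close>; the rows are tested against the weight \<open>b\<close> itself, so that the
  Cauchy--Schwarz inequality splits \<open>\<bar>g a\<bar>\<close> as \<open>sqrt (\<bar>g\<bar> b) * (sqrt (\<bar>g\<bar> / b) \<bar>a\<bar>)\<close>.
\<close>

lemma weighted_convolution:
  fixes g a :: "nat \<Rightarrow> complex" and b :: "nat \<Rightarrow> real"
  assumes b: "\<And>n. b n > 0"
    and g: "summable (\<lambda>k. norm (g k))"
    and C: "\<And>m. (\<Sum>n\<le>m. norm (g (m - n)) * b n) \<le> C * b m"
    and a: "summable (\<lambda>n. (norm (a n))\<^sup>2 / b n)"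
  shows "summable (\<lambda>m. (norm (\<Sum>n\<le>m. g (m - n) * a n))\<^sup>2 / b m)" (is "summable ?c")
    and "(\<Sum>m. (norm (\<Sum>n\<le>m. g (m - n) * a n))\<^sup>2 / b m)
           \<le> C * (\<Sum>k. norm (g k)) * (\<Sum>n. (norm (a n))\<^sup>2 / b n)"
proof -
  define P where "P = (\<lambda>m. \<Sum>n\<le>m. (norm (a n))\<^sup>2 / b n * norm (g (m - n)))"
  have P: "P sums ((\<Sum>n. (norm (a n))\<^sup>2 / b n) * (\<Sum>k. norm (g k)))"
    unfolding P_def
    by (rule Cauchy_product_sums) (use g a b in \<open>simp_all add: abs_of_pos\<close>)
  have le: "?c m \<le> C * P m" for m
  proof -
    have P0: "P m \<ge> 0"
      unfolding P_def using b by (intro sum_nonneg) (simp add: less_imp_le)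
    have "norm (\<Sum>n\<le>m. g (m - n) * a n) \<le> (\<Sum>n\<le>m. norm (g (m - n)) * norm (a n))"
      by (rule order_trans[OF norm_sum]) (simp add: norm_mult)
    also have "\<dots> = (\<Sum>n\<le>m. sqrt (norm (g (m - n)) * b n)
                              * (sqrt (norm (g (m - n)) / b n) * norm (a n)))"
    proof (rule sum.cong)
      fix n
      have "sqrt (norm (g (m - n)) * b n) * sqrt (norm (g (m - n)) / b n)
              = sqrt ((norm (g (m - n)))\<^sup>2)"
        using b[of n] by (simp flip: real_sqrt_mult add: power2_eq_square)
      then show "norm (g (m - n)) * norm (a n) = sqrt (norm (g (m - n)) * b n)
                              * (sqrt (norm (g (m - n)) / b n) * norm (a n))"
        by simp
    qed simp
    finally have "(norm (\<Sum>n\<le>m. g (m - n) * a n))\<^sup>2 \<le> \<dots>\<^sup>2"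
      by (rule power_mono) simp
    also have "\<dots> \<le> (\<Sum>n\<le>m. (sqrt (norm (g (m - n)) * b n))\<^sup>2) *
                      (\<Sum>n\<le>m. (sqrt (norm (g (m - n)) / b n) * norm (a n))\<^sup>2)"
      by (rule Cauchy_Schwarz_ineq_sum)
    also have "\<dots> = (\<Sum>n\<le>m. norm (g (m - n)) * b n) * P m"
      unfolding P_def using b by (simp add: power_mult_distrib less_imp_le mult.commute)
    also have "\<dots> \<le> (C * b m) * P m"
      using C P0 by (rule mult_right_mono)
    finally show ?thesis using b[of m] by (simp add: field_simps)
  qed
  have sCP: "summable (\<lambda>m. C * P m)"
    using P by (simp add: sums_iff summable_mult)
  show S: "summable ?c"
    by (rule summable_comparison_test'[OF sCP, of 0]) (use le b in \<open>simp add: less_imp_le\<close>)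
  have "suminf ?c \<le> (\<Sum>m. C * P m)"
    by (rule suminf_le[OF le S sCP])
  also have "\<dots> = C * (\<Sum>m. P m)"
    using P by (simp add: sums_iff suminf_mult)
  finally show "suminf ?c \<le> C * (\<Sum>k. norm (g k)) * (\<Sum>n. (norm (a n))\<^sup>2 / b n)"
    using P by (simp add: sums_iff mult_ac)
qed

lemma summable_geometric_powr:
  fixes \<rho> p :: real
  assumes "0 \<le> \<rho>" "\<rho> < 1"
  shows "summable (\<lambda>k. \<rho> ^ k * (real k + 1) powr p)"
proof (cases "\<rho> = 0")
  case True
  then show ?thesis by (intro summable_finite[of "{0}"]) auto
next
  case False
  with assms have \<rho>: "0 < \<rho>" "\<rho> < 1" by auto
  show ?thesis
  proof (rule summable_comparison_test_bigo)
    show "summable (\<lambda>k. norm (real k powr (-2)))"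
      by (simp add: summable_real_powr_iff)
    show "(\<lambda>k. \<rho> ^ k * (real k + 1) powr p) \<in> O(\<lambda>k. real k powr (-2))"
      using \<rho> by real_asymp
  qed
qed

text \<open>
  For negative \<open>\<gamma>\<close> this is the inequality \<open>m + 1 \<le> (m - n + 1) (n + 1)\<close>.
\<close>

lemma powr_ratio_bound:
  fixes \<gamma> :: real
  assumes "n \<le> m"
  shows "(real n + 1) powr \<gamma> \<le> (real (m - n) + 1) powr \<bar>\<gamma>\<bar> * (real m + 1) powr \<gamma>"
proof (cases "\<gamma> \<ge> 0")
  case True
  have "(real n + 1) powr \<gamma> \<le> 1 * (real m + 1) powr \<gamma>"
    using True assms by (simp add: powr_mono2)
  also have "\<dots> \<le> (real (m - n) + 1) powr \<bar>\<gamma>\<bar> * (real m + 1) powr \<gamma>"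
    by (intro mult_right_mono) (simp_all add: ge_one_powr_ge_zero)
  finally show ?thesis .
next
  case False
  have "real m + 1 \<le> (real (m - n) + 1) * (real n + 1)"
    using assms mult_right_mono[of "real n" "real m" "real n"] by (simp add: of_nat_diff algebra_simps)
  then have "(real m + 1) powr (-\<gamma>) \<le> (real (m - n) + 1) powr (-\<gamma>) * (real n + 1) powr (-\<gamma>)"
    using False by (subst powr_mult[symmetric]) (auto intro!: powr_mono2)
  then show ?thesis
    using False by (simp add: powr_minus field_simps)
qed

text \<open>
  The coefficients, in absolute value, of a disc automorphism with zero of modulus \<open>t\<close>.
\<close>

definition Moebius_weight :: "real \<Rightarrow> nat \<Rightarrow> real" where
  "Moebius_weight t k = (if k = 0 then t else (1 - t\<^sup>2) * t ^ (k - 1))"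

lemma Moebius_weight_nonneg: "\<lbrakk>0 \<le> t; t < 1\<rbrakk> \<Longrightarrow> Moebius_weight t k \<ge> 0"
  by (auto simp: Moebius_weight_def power_le_one)

lemma Moebius_weight_sums:
  assumes "0 \<le> t" "t < 1"
  shows "Moebius_weight t sums (1 + 2 * t)"
proof -
  have "(\<lambda>k. (1 - t\<^sup>2) * t ^ k) sums ((1 - t\<^sup>2) * (1 / (1 - t)))"
    using assms by (intro sums_mult geometric_sums) auto
  moreover have "(1 - t\<^sup>2) * (1 / (1 - t)) = 1 + t"
    using assms by (simp add: field_simps power2_eq_square)
  ultimately have "(\<lambda>k. Moebius_weight t (Suc k)) sums (1 + t)"
    by (simp add: Moebius_weight_def)
  then show ?thesis
    by (subst (asm) sums_Suc_iff) (simp add: Moebius_weight_def add.commute)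
qed

lemma Moebius_weight_row_sum:
  assumes "0 \<le> t" "t < 1"
  shows "(\<Sum>n\<le>m. Moebius_weight t (m - n)) \<le> 3"
proof -
  have "(\<Sum>n\<le>m. Moebius_weight t (m - n)) = (\<Sum>k\<le>m. Moebius_weight t k)"
    by (rule sum.reindex_bij_witness[of _ "\<lambda>k. m - k" "\<lambda>n. m - n"]) auto
  also have "\<dots> \<le> (\<Sum>k. Moebius_weight t k)"
    using Moebius_weight_nonneg[OF assms] sums_summable[OF Moebius_weight_sums[OF assms]]
    by (intro sum_le_suminf) auto
  also have "\<dots> \<le> 3"
    using assms sums_unique[OF Moebius_weight_sums[OF assms]] by simp
  finally show ?thesis .
qed

text \<open>
  The left-hand side is a lower Riemann sum for the integral of \<open>x powr \<gamma>\<close> over \<open>{0..m}\<close>.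
\<close>

lemma sum_powr_le:
  fixes \<gamma> :: real
  assumes "\<gamma> > -1" "\<gamma> \<le> 0"
  shows "(\<Sum>n<m. (real n + 1) powr \<gamma>) \<le> real m powr (\<gamma> + 1) / (\<gamma> + 1)"
proof (induction m)
  case (Suc m)
  have step: "(\<gamma> + 1) * (real m + 1) powr \<gamma> \<le> (real m + 1) powr (\<gamma> + 1) - real m powr (\<gamma> + 1)"
  proof (cases "m = 0")
    case True
    then show ?thesis using assms by simp
  next
    case False
    have "\<exists>z. real m < z \<and> z < real m + 1 \<and>
            (real m + 1) powr (\<gamma> + 1) - real m powr (\<gamma> + 1)
              = (real m + 1 - real m) * ((\<gamma> + 1) * z powr \<gamma>)"
      using False by (intro MVT2) (auto intro!: derivative_eq_intros simp: field_simps)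
    then obtain z where z: "real m < z" "z < real m + 1"
      "(real m + 1) powr (\<gamma> + 1) - real m powr (\<gamma> + 1) = (\<gamma> + 1) * z powr \<gamma>"
      by auto
    have "(real m + 1) powr \<gamma> \<le> z powr \<gamma>"
      using z assms by (intro powr_mono2') auto
    then show ?thesis using z(3) assms by simp
  qed
  have "(\<Sum>n<Suc m. (real n + 1) powr \<gamma>)
          \<le> real m powr (\<gamma> + 1) / (\<gamma> + 1) + (real m + 1) powr \<gamma>"
    using Suc.IH by simp
  also have "\<dots> \<le> real (Suc m) powr (\<gamma> + 1) / (\<gamma> + 1)"
  proof -
    have "(real m + 1) powr \<gamma>
            \<le> ((real m + 1) powr (\<gamma> + 1) - real m powr (\<gamma> + 1)) / (\<gamma> + 1)"
      using step assms by (simp add: pos_le_divide_eq mult.commute)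
    then show ?thesis by (simp add: diff_divide_distrib add.commute)
  qed
  finally show ?case .
qed auto

text \<open>
  The power \<open>t ^ j\<close> is the least of the \<open>j + 1\<close> terms of the geometric sum
  \<open>\<Sum>i\<le>j. t ^ i\<close>, whose product with \<open>1 - t\<close> is at most \<open>1\<close>.
\<close>

lemma power_mult_one_minus_le:
  fixes t :: real
  assumes "0 \<le> t" "t \<le> 1"
  shows "(1 - t) * t ^ j \<le> 1 / (real j + 1)"
proof -
  have "(real j + 1) * t ^ j = (\<Sum>i<Suc j. t ^ j)" by simp
  also have "\<dots> \<le> (\<Sum>i<Suc j. t ^ i)"
    using assms by (intro sum_mono power_decreasing) auto
  finally have "(1 - t) * ((real j + 1) * t ^ j) \<le> (1 - t) * (\<Sum>i<Suc j. t ^ i)"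
    using assms by (intro mult_left_mono) auto
  also have "\<dots> = 1 - t ^ Suc j" by (rule one_diff_power_eq[symmetric])
  also have "\<dots> \<le> 1" using assms by simp
  finally show ?thesis by (simp add: field_simps)
qed

text \<open>
  The row condition of Schur's test for automorphisms. For \<open>\<gamma> \<ge> 0\<close> the weight increases, and the
  row sums of the matrix suffice. Otherwise, in a row \<open>m\<close>, the entries with \<open>n \<ge> m / 2\<close>
  see a weight comparable with the one at \<open>m\<close>. The entries with \<open>n < m / 2\<close> are at most of order
  \<open>1 / m\<close> uniformly in \<open>t\<close>, and the mean of \<open>(n + 1) powr \<gamma>\<close> over \<open>n < m\<close> is of order
  \<open>m powr \<gamma>\<close> exactly when \<open>\<gamma> > -1\<close>.
\<close>

lemma Moebius_weight_Schur:
  fixes \<gamma> :: real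
  assumes \<gamma>: "\<gamma> > -1"
  shows "\<exists>C>0. \<forall>t m. 0 \<le> t \<longrightarrow> t < 1 \<longrightarrow>
    (\<Sum>n\<le>m. Moebius_weight t (m - n) * (real n + 1) powr \<gamma>) \<le> C * (real m + 1) powr \<gamma>"
proof (cases "\<gamma> \<ge> 0")
  case True
  have "(\<Sum>n\<le>m. Moebius_weight t (m - n) * (real n + 1) powr \<gamma>) \<le> 3 * (real m + 1) powr \<gamma>"
    if t: "0 \<le> t" "t < 1" for t m
  proof -
    have "(\<Sum>n\<le>m. Moebius_weight t (m - n) * (real n + 1) powr \<gamma>)
            \<le> (\<Sum>n\<le>m. Moebius_weight t (m - n) * (real m + 1) powr \<gamma>)"
      using True t by (intro sum_mono mult_left_mono powr_mono2 Moebius_weight_nonneg) auto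
    also have "\<dots> \<le> 3 * (real m + 1) powr \<gamma>"
      using Moebius_weight_row_sum[OF t]
      unfolding sum_distrib_right[symmetric] by (intro mult_right_mono) auto
    finally show ?thesis .
  qed
  then show ?thesis by (intro exI[of _ 3]) auto
next
  case False
  define C where "C = 3 * 2 powr (-\<gamma>) + 4 / (\<gamma> + 1)"
  have "(\<Sum>n\<le>m. Moebius_weight t (m - n) * (real n + 1) powr \<gamma>) \<le> C * (real m + 1) powr \<gamma>"
    if t: "0 \<le> t" "t < 1" for t m
  proof -
    have le: "Moebius_weight t (m - n) * (real n + 1) powr \<gamma>
            \<le> 2 powr (-\<gamma>) * (real m + 1) powr \<gamma> * Moebius_weight t (m - n)
              + (if n < m then 4 / (real m + 1) * (real n + 1) powr \<gamma> else 0)"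
      if n: "n \<le> m" for n
    proof (cases "real m + 1 \<le> 2 * (real n + 1)")
      case near: True
      have "(2 * (real n + 1)) powr \<gamma> \<le> (real m + 1) powr \<gamma>"
        using False near by (intro powr_mono2') auto
      also have "(2 * (real n + 1)) powr \<gamma> = 2 powr \<gamma> * (real n + 1) powr \<gamma>"
        by (rule powr_mult) 
      finally have "(real n + 1) powr \<gamma> \<le> 2 powr (-\<gamma>) * (real m + 1) powr \<gamma>"
        by (simp add: powr_minus field_simps)
      from mult_left_mono[OF this Moebius_weight_nonneg[OF t, of "m - n"]]
      have "Moebius_weight t (m - n) * (real n + 1) powr \<gamma>
            \<le> 2 powr (-\<gamma>) * (real m + 1) powr \<gamma> * Moebius_weight t (m - n)"
        by (simp add: mult_ac)
      then show ?thesis by (simp add: add_increasing2)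
    next
      case far: False
      then have nm: "n < m" by auto
      define j where "j = m - n - 1"
      have j: "m - n = Suc j" using nm by (simp add: j_def)
      have jm: "real j + 1 \<ge> (real m + 1) / 2"
        using far nm by (simp add: j_def of_nat_diff)
      have "Moebius_weight t (m - n) = (1 + t) * ((1 - t) * t ^ j)"
        by (simp add: Moebius_weight_def j algebra_simps power2_eq_square)
      also have "\<dots> \<le> 2 * (1 / (real j + 1))"
        using t power_mult_one_minus_le[of t j] by (intro mult_mono) auto
      also have "\<dots> \<le> 4 / (real m + 1)"
        using jm by (simp add: field_simps)
      finally have "Moebius_weight t (m - n) * (real n + 1) powr \<gamma>
          \<le> 4 / (real m + 1) * (real n + 1) powr \<gamma>"
        by (intro mult_right_mono) auto
      then show ?thesis
        using nm Moebius_weight_nonneg[OF t] by (simp add: add_increasing)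
    qed
    have "(\<Sum>n\<le>m. Moebius_weight t (m - n) * (real n + 1) powr \<gamma>)
       \<le> 2 powr (-\<gamma>) * (real m + 1) powr \<gamma> * (\<Sum>n\<le>m. Moebius_weight t (m - n))
         + (\<Sum>n\<le>m. if n < m then 4 / (real m + 1) * (real n + 1) powr \<gamma> else 0)"
      unfolding sum_distrib_left sum.distrib[symmetric] using le by (intro sum_mono) auto
    also have "(\<Sum>n\<le>m. if n < m then 4 / (real m + 1) * (real n + 1) powr \<gamma> else 0)
                 = 4 / (real m + 1) * (\<Sum>n<m. (real n + 1) powr \<gamma>)"
      by (simp add: lessThan_Suc_atMost[symmetric] sum_distrib_left)
    also have "2 powr (-\<gamma>) * (real m + 1) powr \<gamma> * (\<Sum>n\<le>m. Moebius_weight t (m - n))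
                 \<le> 2 powr (-\<gamma>) * (real m + 1) powr \<gamma> * 3"
      using Moebius_weight_row_sum[OF t] by (intro mult_left_mono) auto
    also have "4 / (real m + 1) * (\<Sum>n<m. (real n + 1) powr \<gamma>)
                 \<le> 4 / (real m + 1) * ((real m + 1) powr (\<gamma> + 1) / (\<gamma> + 1))"
    proof (intro mult_left_mono)
      have "(\<Sum>n<m. (real n + 1) powr \<gamma>) \<le> real m powr (\<gamma> + 1) / (\<gamma> + 1)"
        using False \<gamma> by (intro sum_powr_le) auto
      also have "\<dots> \<le> (real m + 1) powr (\<gamma> + 1) / (\<gamma> + 1)"
        using \<gamma> by (intro divide_right_mono powr_mono2) auto
      finally show "(\<Sum>n<m. (real n + 1) powr \<gamma>) \<le> (real m + 1) powr (\<gamma> + 1) / (\<gamma> + 1)" .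
    qed simp
    also have "\<dots> = 4 / (\<gamma> + 1) * (real m + 1) powr \<gamma>"
      by (simp add: powr_add)
    finally show ?thesis by (simp add: C_def algebra_simps)
  qed
  moreover have "C > 0" using \<gamma> by (auto simp: C_def intro!: add_pos_pos)
  ultimately show ?thesis by blast
qed

section \<open>Power series on the unit disc\<close>

definition taylor :: "(complex \<Rightarrow> complex) \<Rightarrow> nat \<Rightarrow> complex" where
  "taylor f n = (deriv ^^ n) f 0 / fact n"

lemma taylor_sums:
  "\<lbrakk>f holomorphic_on unit_disc; z \<in> unit_disc\<rbrakk> \<Longrightarrow> (\<lambda>n. taylor f n * z ^ n) sums f z"
  using holomorphic_power_series[of f 0 1 z] by (simp add: taylor_def)

lemma taylor_unique:
  assumes "\<And>z. z \<in> unit_disc \<Longrightarrow> (\<lambda>n. a n * z ^ n) sums f z"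
  shows "taylor f n = a n"
proof -
  have "\<forall>\<^sub>F z in nhds 0. z \<in> unit_disc"
    by (intro eventually_nhds_in_open) auto
  then have "f has_fps_expansion Abs_fps a"
    by (intro has_fps_expansionI, rule eventually_mono) (use assms in simp)
  then show ?thesis using fps_nth_fps_expansion[of f "Abs_fps a" n] by (simp add: taylor_def)
qed

lemma taylor_summable_norm:
  assumes "f holomorphic_on unit_disc" "z \<in> unit_disc"
  shows "summable (\<lambda>n. norm (taylor f n * z ^ n))"
proof -
  obtain r where r: "norm z < r" "r < 1"
    using assms(2) dense[of "norm z" 1] by auto
  then have r0: "r > 0" using norm_ge_zero[of z] by linarith
  have "(\<lambda>n. taylor f n * (of_real r) ^ n) sums f (of_real r)"
    using r r0 by (intro taylor_sums assms) auto
  from powser_insidea[OF sums_summable[OF this], of z] show ?thesis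
    using r r0 by simp
qed

lemma mult_series_sums:
  assumes f: "f holomorphic_on unit_disc"
    and G: "\<And>z. z \<in> unit_disc \<Longrightarrow> (\<lambda>k. g k * z ^ k) sums G z"
    and g: "summable (\<lambda>k. norm (g k))" and z: "z \<in> unit_disc"
  shows "(\<lambda>m. (\<Sum>n\<le>m. g (m - n) * taylor f n) * z ^ m) sums (G z * f z)"
proof -
  have gz: "summable (\<lambda>k. norm (g k * z ^ k))"
  proof (rule summable_comparison_test'[OF g, of 0])
    show "norm (norm (g k * z ^ k)) \<le> norm (g k)" for k
      using z by (simp add: norm_mult norm_power mult_left_le power_le_one)
  qed
  have "(\<lambda>m. \<Sum>n\<le>m. (taylor f n * z ^ n) * (g (m - n) * z ^ (m - n))) sums
          ((\<Sum>k. taylor f k * z ^ k) * (\<Sum>k. g k * z ^ k))"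
    by (rule Cauchy_product_sums[OF taylor_summable_norm[OF f z] gz])
  also have "(\<Sum>k. taylor f k * z ^ k) * (\<Sum>k. g k * z ^ k) = G z * f z"
    using taylor_sums[OF f z] G[OF z] by (simp add: sums_iff)
  also have "(\<lambda>m. \<Sum>n\<le>m. (taylor f n * z ^ n) * (g (m - n) * z ^ (m - n)))
               = (\<lambda>m. (\<Sum>n\<le>m. g (m - n) * taylor f n) * z ^ m)"
  proof
    fix m
    have "(taylor f n * z ^ n) * (g (m - n) * z ^ (m - n)) = g (m - n) * taylor f n * z ^ m"
      if "n \<le> m" for n
    proof -
      have "z ^ m = z ^ n * z ^ (m - n)" using that by (simp flip: power_add)
      then show ?thesis by (simp add: mult_ac)
    qed
    then show "(\<Sum>n\<le>m. (taylor f n * z ^ n) * (g (m - n) * z ^ (m - n)))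
                 = (\<Sum>n\<le>m. g (m - n) * taylor f n) * z ^ m"
      unfolding sum_distrib_right by (intro sum.cong) auto
  qed
  finally show ?thesis .
qed

section \<open>The space as a weighted sequence space\<close>

locale power_weight_space = disc_rkhs H ip "power_kernel b"
  for H :: "(complex \<Rightarrow> complex) set"
    and ip :: "(complex \<Rightarrow> complex) \<Rightarrow> (complex \<Rightarrow> complex) \<Rightarrow> complex"
    and b :: "nat \<Rightarrow> real" +
  fixes \<gamma> :: real
  assumes b_pos: "b n > 0"
    and b_comparable: "comparable b (\<lambda>n. (real n + 1) powr \<gamma>)"
begin

lemma b_nonzero [simp]: "b n \<noteq> 0"
  using b_pos[of n] by simp

lemma b_ratio:
  "\<exists>C>0. \<forall>m n. n \<le> m \<longrightarrow> b n \<le> C * (real (m - n) + 1) powr \<bar>\<gamma>\<bar> * b m"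
proof -
  obtain c1 c2 where c12: "c1 > 0" "c2 > 0"
    "\<forall>n. c1 * (real n + 1) powr \<gamma> \<le> b n \<and> b n \<le> c2 * (real n + 1) powr \<gamma>"
    using b_comparable unfolding comparable_def by blast
  then have c: "c1 > 0" "c2 > 0" "c1 * (real n + 1) powr \<gamma> \<le> b n"
    "b n \<le> c2 * (real n + 1) powr \<gamma>" for n by auto
  have "b n \<le> c2 / c1 * (real (m - n) + 1) powr \<bar>\<gamma>\<bar> * b m" if "n \<le> m" for m n
  proof -
    have "b n \<le> c2 * (real n + 1) powr \<gamma>" by (rule c)
    also have "\<dots> \<le> c2 * ((real (m - n) + 1) powr \<bar>\<gamma>\<bar> * (real m + 1) powr \<gamma>)"
      using c(2) powr_ratio_bound[OF that] by (intro mult_left_mono) auto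
    also have "\<dots> \<le> c2 * ((real (m - n) + 1) powr \<bar>\<gamma>\<bar> * (b m / c1))"
    proof (intro mult_left_mono)
      show "(real m + 1) powr \<gamma> \<le> b m / c1"
        using c(1) c(3)[of m] by (simp add: pos_le_divide_eq mult.commute)
    qed (use c(2) in auto)
    also have "\<dots> = c2 / c1 * (real (m - n) + 1) powr \<bar>\<gamma>\<bar> * b m"
      by (simp only: times_divide_eq_left times_divide_eq_right mult.assoc)
    finally show ?thesis .
  qed
  then show ?thesis using c(1,2) by (intro exI[of _ "c2 / c1"]) simp
qed

lemma summable_b_power:
  fixes x :: complex
  assumes "norm x < 1"
  shows "summable (\<lambda>n. of_real (b n) * x ^ n)"
proof -
  obtain c1 c2 where c12: "c1 > 0" "c2 > 0"
    "\<forall>n. c1 * (real n + 1) powr \<gamma> \<le> b n \<and> b n \<le> c2 * (real n + 1) powr \<gamma>"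
    using b_comparable unfolding comparable_def by blast
  then have c: "c1 > 0" "c2 > 0" "c1 * (real n + 1) powr \<gamma> \<le> b n"
    "b n \<le> c2 * (real n + 1) powr \<gamma>" for n by auto
  have S: "summable (\<lambda>n. c2 * (norm x ^ n * (real n + 1) powr \<gamma>))"
    using assms by (intro summable_mult summable_geometric_powr) auto
  have "norm (of_real (b n) * x ^ n) \<le> c2 * (norm x ^ n * (real n + 1) powr \<gamma>)" for n
    using mult_right_mono[OF c(4)[of n], of "norm x ^ n"] b_pos[of n]
    by (simp add: norm_mult norm_power mult_ac)
  then show ?thesis by (rule summable_comparison_test'[OF S, of 0])
qed

definition kernel_at :: "complex \<Rightarrow> complex \<Rightarrow> complex" where
  "kernel_at w = (\<lambda>z. if z \<in> unit_disc then power_kernel b z w else 0)"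

definition monomial :: "nat \<Rightarrow> complex \<Rightarrow> complex" where
  "monomial n = (\<lambda>z. if z \<in> unit_disc then z ^ n else 0)"

lemma kernel_at_mem: "w \<in> unit_disc \<Longrightarrow> kernel_at w \<in> H"
  unfolding kernel_at_def by (rule kernel_mem)

lemma ip_kernel_at: "\<lbrakk>f \<in> H; w \<in> unit_disc\<rbrakk> \<Longrightarrow> ip f (kernel_at w) = f w"
  unfolding kernel_at_def by (rule reproducing)

lemma kernel_at_sums:
  assumes "w \<in> unit_disc" "z \<in> unit_disc"
  shows "(\<lambda>n. (of_real (b n) * cnj w ^ n) * z ^ n) sums kernel_at w z"
proof -
  have "norm (z * cnj w) < 1"
    using assms mult_strict_mono'[of "norm z" 1 "norm w" 1] by (simp add: norm_mult)
  from summable_sums[OF summable_b_power[OF this]] show ?thesis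
    using assms by (simp add: kernel_at_def power_kernel_def power_mult_distrib mult_ac)
qed

lemma taylor_kernel_at: "w \<in> unit_disc \<Longrightarrow> taylor (kernel_at w) n = of_real (b n) * cnj w ^ n"
  by (intro taylor_unique kernel_at_sums)

lemma taylor_monomial: "taylor (monomial n) m = (if m = n then 1 else 0)"
proof (rule taylor_unique)
  fix z :: complex
  assume "z \<in> unit_disc"
  then show "(\<lambda>m. (if m = n then 1 else 0) * z ^ m) sums monomial n z"
    using powser_sums_if[of n z] by (simp add: monomial_def)
qed

lemma H_eqI:
  assumes "f \<in> H" "\<And>z. z \<in> unit_disc \<Longrightarrow> f z = g z" "\<And>z. z \<notin> unit_disc \<Longrightarrow> g z = 0"
  shows "f = g"
proof
  fix z show "f z = g z"
    using assms vanishes[of f z] by (cases "z \<in> unit_disc") simp_all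
qed

text \<open>
  The monomials are recovered from the kernel by induction: as \<open>w\<close> tends to \<open>0\<close> along the reals,
  the difference quotient \<open>(k\<^sub>w - (\<Sum>m<n. b m w ^ m z ^ m)) / w ^ n\<close>, a member of the space, tends
  to \<open>b n z ^ n\<close>. By the reproducing property its inner product with \<open>f\<close> is the corresponding
  Taylor remainder of \<open>f\<close>, which tends to the \<open>n\<close>-th coefficient.
\<close>

lemma monomial_mem_ip:
  "monomial n \<in> H \<and> (\<forall>f\<in>H. ip f (monomial n) = taylor f n / of_real (b n))"
proof (induction n rule: less_induct)
  case (less n)
  define w :: "nat \<Rightarrow> complex" where "w j = of_real (1 / (real j + 2))" for j
  have norm_w: "norm (w j) = 1 / (real j + 2)" for j
    unfolding w_def norm_of_real by simp
  have w: "w j \<in> unit_disc" "w j \<noteq> 0" "cnj (w j) = w j" for j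
    using norm_w[of j] by (auto simp: w_def simp del: of_real_add of_real_divide)
  have w_lim: "w \<longlonglongrightarrow> 0"
  proof (rule tendsto_norm_zero_cancel)
    show "(\<lambda>j. norm (w j)) \<longlonglongrightarrow> 0" unfolding norm_w by real_asymp
  qed
  define q where "q j = (\<lambda>z. inverse (w j ^ n) *
     (kernel_at (w j) z - (\<Sum>m<n. (of_real (b m) * w j ^ m) * monomial m z)))" for j
  have mono: "(\<lambda>z. (of_real (b m) * w j ^ m) * monomial m z) \<in> H" if "m < n" for m j
    using less.IH[OF that] by (intro scale_mem) simp
  have D: "(\<lambda>z. \<Sum>m<n. (of_real (b m) * w j ^ m) * monomial m z) \<in> H" for j
    using mono by (intro sum_mem) auto
  have q_mem: "q j \<in> H" for j
    unfolding q_def by (rule scale_mem[OF diff_mem[OF kernel_at_mem[OF w(1)] D]])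
  have ip_q: "ip f (q j) = (\<Sum>k. taylor f (k + n) * w j ^ k)" if f: "f \<in> H" for f j
  proof -
    have tf: "(\<lambda>m. taylor f m * w j ^ m) sums f (w j)"
      by (rule taylor_sums[OF holomorphic[OF f] w(1)])
    have "ip f (q j) = inverse (w j ^ n) *
        (f (w j) - (\<Sum>m<n. ip f (\<lambda>z. (of_real (b m) * w j ^ m) * monomial m z)))"
    proof -
      have "ip f (\<lambda>z. \<Sum>m<n. (of_real (b m) * w j ^ m) * monomial m z)
              = (\<Sum>m<n. ip f (\<lambda>z. (of_real (b m) * w j ^ m) * monomial m z))"
        using mono f by (intro ip_sum_right) auto
      then show ?thesis
        unfolding q_def ip_scale_right[OF diff_mem[OF kernel_at_mem[OF w(1)] D] f]
          ip_diff_right[OF kernel_at_mem[OF w(1)] D f] ip_kernel_at[OF f w(1)]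
        by (simp add: w(3))
    qed
    also have "(\<Sum>m<n. ip f (\<lambda>z. (of_real (b m) * w j ^ m) * monomial m z))
                 = (\<Sum>m<n. taylor f m * w j ^ m)"
    proof (rule sum.cong)
      fix m assume "m \<in> {..<n}"
      then have m: "monomial m \<in> H" "ip f (monomial m) = taylor f m / of_real (b m)"
        using less.IH f by auto
      show "ip f (\<lambda>z. (of_real (b m) * w j ^ m) * monomial m z) = taylor f m * w j ^ m"
        unfolding ip_scale_right[OF m(1) f] m(2) by (simp add: w(3))
    qed simp
    also have "f (w j) - \<dots> = (\<Sum>k. taylor f (k + n) * w j ^ (k + n))"
      using suminf_split_initial_segment[OF sums_summable[OF tf], of n] sums_unique[OF tf] by simp
    also have "\<dots> = w j ^ n * (\<Sum>k. taylor f (k + n) * w j ^ k)"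
    proof -
      have "summable (\<lambda>k. taylor f (k + n) * w j ^ k)"
        using sums_summable[OF tf] by (simp add: summable_powser_ignore_initial_segment)
      from suminf_mult[OF this, of "w j ^ n"] show ?thesis
        by (simp add: power_add mult_ac)
    qed
    finally show ?thesis using w by simp
  qed
  have taylor_q: "taylor (q j) m = (if m < n then 0 else of_real (b m) * w j ^ (m - n))" for j m
  proof (rule taylor_unique)
    fix z assume z: "z \<in> unit_disc"
    have "(\<lambda>m. if m \<in> {..<n} then of_real (b m) * w j ^ m * z ^ m else 0)
            sums (\<Sum>m<n. of_real (b m) * w j ^ m * z ^ m)"
      by (rule sums_If_finite_set) simp
    from sums_mult[OF sums_diff[OF kernel_at_sums[OF w(1) z] this], of "inverse (w j ^ n)"]
    have "(\<lambda>m. inverse (w j ^ n) * (of_real (b m) * w j ^ m * z ^ m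
             - (if m \<in> {..<n} then of_real (b m) * w j ^ m * z ^ m else 0))) sums q j z"
      using z w by (simp add: q_def monomial_def)
    moreover have "inverse (w j ^ n) * (of_real (b m) * w j ^ m * z ^ m
             - (if m \<in> {..<n} then of_real (b m) * w j ^ m * z ^ m else 0))
           = (if m < n then 0 else of_real (b m) * w j ^ (m - n)) * z ^ m" for m
      using w(2)[of j] by (simp add: power_diff field_simps)
    ultimately show "(\<lambda>m. (if m < n then 0 else of_real (b m) * w j ^ (m - n)) * z ^ m) sums q j z"
      by simp
  qed
  (* the Gram matrix of the quotients q i depends on the product w i * w j only *)
  define G where "G x = (\<Sum>k. of_real (b (k + n)) * x ^ k)" for x :: complex
  have G_lim: "(G \<longlongrightarrow> of_real (b n)) (at 0)"
  proof -
    have "(G \<longlongrightarrow> of_real (b (0 + n))) (at 0)"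
    proof (rule powser_limit_0)
      show "(\<lambda>k. of_real (b (k + n)) * x ^ k) sums G x" if "norm x < 1" for x
        unfolding G_def using summable_b_power[OF that]
        by (intro summable_sums) (simp add: summable_powser_ignore_initial_segment[where f = "\<lambda>n. of_real (b n)"])
    qed simp
    then show ?thesis by simp
  qed
  have Gram: "ip (q i) (q j) = G (w i * w j)" for i j
    unfolding ip_q[OF q_mem] G_def by (simp add: taylor_q power_mult_distrib mult_ac)
  have "\<exists>N. \<forall>i\<ge>N. \<forall>j\<ge>N. norm (ip (q i) (q j) - of_real (b n)) < e" if "e > 0" for e
  proof -
    obtain d where d: "d > 0"
      "\<And>x. x \<noteq> 0 \<Longrightarrow> norm x < d \<Longrightarrow> norm (G x - of_real (b n)) < e"
      using LIM_D[OF G_lim \<open>e > 0\<close>] by auto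
    obtain N where N: "\<And>j. j \<ge> N \<Longrightarrow> norm (w j) < d"
      using LIMSEQ_D[OF w_lim \<open>d > 0\<close>] by auto
    have "norm (ip (q i) (q j) - of_real (b n)) < e" if "i \<ge> N" "j \<ge> N" for i j
    proof -
      have "norm (w i * w j) \<le> norm (w i)"
        using w(1)[of j] by (simp add: norm_mult mult_left_le)
      then show ?thesis
        unfolding Gram using N[OF that(1)] w by (intro d) auto
    qed
    then show ?thesis by blast
  qed
  then obtain L where L: "L \<in> H" "(\<lambda>j. ip_norm ip (\<lambda>x. q j x - L x)) \<longlonglongrightarrow> 0"
    using convergent_if_Gram_convergent[of q "of_real (b n)"] q_mem by blast
  have ip_L: "ip f L = taylor f n" if f: "f \<in> H" for f
  proof -
    have "((\<lambda>x. \<Sum>k. taylor f (k + n) * x ^ k) \<longlongrightarrow> taylor f (0 + n)) (at 0)"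
    proof (rule powser_limit_0)
      show "(\<lambda>k. taylor f (k + n) * x ^ k) sums (\<Sum>k. taylor f (k + n) * x ^ k)"
        if "norm x < 1" for x
        using sums_summable[OF taylor_sums[OF holomorphic[OF f], of x]] that
        by (intro summable_sums) (simp add: summable_powser_ignore_initial_segment)
    qed simp
    moreover have "filterlim w (at 0) sequentially"
      using w_lim w by (simp add: filterlim_at)
    ultimately have "(\<lambda>j. \<Sum>k. taylor f (k + n) * w j ^ k) \<longlonglongrightarrow> taylor f n"
      using filterlim_compose by fastforce
    moreover have "(\<lambda>j. ip f (q j)) \<longlonglongrightarrow> ip f L"
      by (rule tendsto_ip_right[OF q_mem L(1) f L(2)])
    ultimately show ?thesis
      unfolding ip_q[OF f] using LIMSEQ_unique by blast
  qed
  have "L z = of_real (b n) * z ^ n" if z: "z \<in> unit_disc" for z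
  proof -
    have "L z = cnj (ip (kernel_at z) L)"
      using ip_kernel_at[OF L(1) z] ip_cnj[OF kernel_at_mem[OF z] L(1)] by simp
    then show ?thesis
      by (simp add: ip_L[OF kernel_at_mem[OF z]] taylor_kernel_at[OF z])
  qed
  then have L_eq: "L = (\<lambda>z. of_real (b n) * monomial n z)"
    by (intro H_eqI[OF L(1)]) (auto simp: monomial_def)
  have mono_eq: "monomial n = (\<lambda>z. of_real (1 / b n) * L z)"
    by (simp add: L_eq)
  show ?case
  proof (intro conjI ballI)
    show "monomial n \<in> H" unfolding mono_eq by (rule scale_mem[OF L(1)])
    show "ip f (monomial n) = taylor f n / of_real (b n)" if "f \<in> H" for f
      unfolding mono_eq by (subst ip_scale_right[OF L(1) that]) (simp add: ip_L[OF that])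
  qed
qed

lemmas monomial_mem = monomial_mem_ip[THEN conjunct1]

lemma ip_monomial: "f \<in> H \<Longrightarrow> ip f (monomial n) = taylor f n / of_real (b n)"
  using monomial_mem_ip by blast

lemma Gram_partial_sum:
  assumes "f \<in> H"
  shows "ip f (\<lambda>z. \<Sum>n<N. a n * monomial n z)
           = (\<Sum>n<N. taylor f n * cnj (a n) / of_real (b n))"
  using assms by (simp add: ip_sum_right scale_mem monomial_mem ip_scale_right ip_monomial mult_ac)

text \<open>
  The partial sums have a convergent Gram matrix, because the monomials are orthogonal. Their limit
  is identified weakly: inner products with a kernel function are point values.
\<close>

lemma series_mem:
  assumes a: "summable (\<lambda>n. (norm (a n))\<^sup>2 / b n)"
  shows "\<exists>L\<in>H. (\<forall>n. taylor L n = a n) \<and>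
    (\<forall>f\<in>H. (\<lambda>n. taylor f n * cnj (a n) / of_real (b n)) sums ip f L)"
proof -
  define S where "S N = (\<lambda>z. \<Sum>n<N. a n * monomial n z)" for N
  have S_mem: "S N \<in> H" for N
    unfolding S_def by (intro sum_mem scale_mem monomial_mem)
  have taylor_S: "taylor (S N) n = (if n < N then a n else 0)" for N n
  proof (rule taylor_unique)
    fix z assume z: "z \<in> unit_disc"
    have "(\<lambda>n. if n \<in> {..<N} then a n * z ^ n else 0) sums (\<Sum>n<N. a n * z ^ n)"
      by (rule sums_If_finite_set) simp
    also have "(\<lambda>n. if n \<in> {..<N} then a n * z ^ n else 0)
                 = (\<lambda>n. (if n < N then a n else 0) * z ^ n)" by auto
    finally show "(\<lambda>n. (if n < N then a n else 0) * z ^ n) sums S N z"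
      using z by (simp add: S_def monomial_def)
  qed
  have Gram: "ip (S M) (S N) = of_real (\<Sum>n<min M N. (norm (a n))\<^sup>2 / b n)" for M N
  proof -
    have "ip (S M) (S N) = (\<Sum>n<N. taylor (S M) n * cnj (a n) / of_real (b n))"
      unfolding S_def[of N] by (rule Gram_partial_sum[OF S_mem])
    also have "\<dots> = (\<Sum>n<min M N. a n * cnj (a n) / of_real (b n))"
      unfolding taylor_S by (intro sum.mono_neutral_cong_right) auto
    finally show ?thesis by (simp add: mult_cnj_eq_norm_sq)
  qed
  define E where "E = (\<Sum>n. (norm (a n))\<^sup>2 / b n)"
  have "\<exists>K. \<forall>M\<ge>K. \<forall>N\<ge>K. norm (ip (S M) (S N) - of_real E) < e" if "e > 0" for e
  proof -
    obtain K where "\<And>N. N \<ge> K \<Longrightarrow> norm ((\<Sum>n<N. (norm (a n))\<^sup>2 / b n) - E) < e"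
      using LIMSEQ_D[OF summable_LIMSEQ[OF a] \<open>e > 0\<close>] by (auto simp: E_def)
    then show ?thesis
      unfolding Gram of_real_diff[symmetric] norm_of_real
      by (intro exI[of _ K]) auto
  qed
  then obtain L where L: "L \<in> H" "(\<lambda>N. ip_norm ip (\<lambda>x. S N x - L x)) \<longlonglongrightarrow> 0"
    using convergent_if_Gram_convergent[of S "of_real E"] S_mem by blast
  have ip_L: "(\<lambda>n. taylor f n * cnj (a n) / of_real (b n)) sums ip f L" if f: "f \<in> H" for f
    using tendsto_ip_right[OF S_mem L(1) f L(2)]
    unfolding sums_def S_def Gram_partial_sum[OF f] .
  have "taylor L n = a n" for n
  proof (rule taylor_unique)
    fix z assume z: "z \<in> unit_disc"
    have "(\<lambda>n. cnj (taylor (kernel_at z) n * cnj (a n) / of_real (b n)))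
            sums cnj (ip (kernel_at z) L)"
      unfolding sums_cnj by (rule ip_L[OF kernel_at_mem[OF z]])
    moreover have "cnj (ip (kernel_at z) L) = L z"
      using ip_kernel_at[OF L(1) z] ip_cnj[OF kernel_at_mem[OF z] L(1)] by simp
    ultimately show "(\<lambda>n. a n * z ^ n) sums L z"
      by (simp add: taylor_kernel_at[OF z] mult.commute)
  qed
  then show ?thesis using L(1) ip_L by blast
qed

lemma eq_if_taylor_eq:
  assumes "f \<in> H" "g \<in> H" "\<And>n. taylor f n = taylor g n"
  shows "f = g"
proof (rule H_eqI[OF assms(1)])
  fix z assume z: "z \<in> unit_disc"
  show "f z = g z"
    using taylor_sums[OF holomorphic[OF assms(1)] z] taylor_sums[OF holomorphic[OF assms(2)] z]
    unfolding assms(3) by (rule sums_unique2)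
qed (use assms vanishes in auto)

text \<open>
  Bessel's inequality for the orthogonal system of monomials.
\<close>

lemma taylor_summable_sq:
  assumes f: "f \<in> H"
  shows "summable (\<lambda>n. (norm (taylor f n))\<^sup>2 / b n)"
proof (rule summableI_nonneg_bounded)
  fix N
  define S where "S = (\<lambda>z. \<Sum>n<N. taylor f n * monomial n z)"
  define E where "E = (\<Sum>n<N. (norm (taylor f n))\<^sup>2 / b n)"
  have S_mem: "S \<in> H"
    unfolding S_def by (intro sum_mem scale_mem monomial_mem)
  have fS: "ip f S = of_real E"
    unfolding S_def Gram_partial_sum[OF f] E_def by (simp add: mult_cnj_eq_norm_sq)
  have "ip S S = (\<Sum>n<N. taylor f n * ip (monomial n) S)"
    by (subst (1) S_def) (simp add: ip_sum ip_scale scale_mem monomial_mem S_mem)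
  also have "\<dots> = (\<Sum>n<N. taylor f n * cnj (ip S (monomial n)))"
    using ip_cnj[OF S_mem monomial_mem] by simp
  also have "\<dots> = (\<Sum>n<N. taylor f n * cnj (taylor f n) / of_real (b n))"
  proof (rule sum.cong)
    fix n assume n: "n \<in> {..<N}"
    have "ip (monomial n) S = (\<Sum>m<N. taylor (monomial n) m * cnj (taylor f m) / of_real (b m))"
      unfolding S_def by (rule Gram_partial_sum[OF monomial_mem])
    also have "\<dots> = cnj (taylor f n) / of_real (b n)"
      using n unfolding taylor_monomial by (subst sum.remove[of _ n]) auto
    finally show "taylor f n * cnj (ip S (monomial n)) = taylor f n * cnj (taylor f n) / of_real (b n)"
      using ip_cnj[OF S_mem monomial_mem] by simp
  qed simp
  finally have SS: "ip S S = of_real E"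
    by (simp add: mult_cnj_eq_norm_sq E_def)
  have "ip (\<lambda>x. f x - S x) (\<lambda>x. f x - S x) = of_real ((ip_norm ip f)\<^sup>2 - E)"
    using f S_mem fS SS ip_cnj[OF f S_mem]
    by (simp add: ip_diff ip_diff_right diff_mem ip_self[OF f])
  then show "(\<Sum>n<N. (norm (taylor f n))\<^sup>2 / b n) \<le> (ip_norm ip f)\<^sup>2"
    using Re_ip_nonneg[OF diff_mem[OF f S_mem]] by (simp add: E_def)
qed (use b_pos in \<open>simp add: less_imp_le\<close>)

lemma ip_sums:
  assumes f: "f \<in> H" and g: "g \<in> H"
  shows "(\<lambda>n. taylor f n * cnj (taylor g n) / of_real (b n)) sums ip f g"
proof -
  obtain L where L: "L \<in> H" "\<And>n. taylor L n = taylor g n"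
    "(\<lambda>n. taylor f n * cnj (taylor g n) / of_real (b n)) sums ip f L"
    using series_mem[OF taylor_summable_sq[OF g]] f by blast
  have "L = g" by (rule eq_if_taylor_eq[OF L(1) g L(2)])
  then show ?thesis using L(3) by simp
qed

lemma norm_sums:
  assumes f: "f \<in> H"
  shows "(\<lambda>n. (norm (taylor f n))\<^sup>2 / b n) sums (ip_norm ip f)\<^sup>2"
proof -
  have "(\<lambda>n. complex_of_real ((norm (taylor f n))\<^sup>2 / b n)) sums of_real ((ip_norm ip f)\<^sup>2)"
    using ip_sums[OF f f] by (simp only: ip_self[OF f]) (simp add: mult_cnj_eq_norm_sq)
  then show ?thesis by (simp only: sums_of_real_iff)
qed

lemma mem_if_summable:
  assumes "summable (\<lambda>n. (norm (a n))\<^sup>2 / b n)"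
    and "\<And>z. z \<in> unit_disc \<Longrightarrow> (\<lambda>n. a n * z ^ n) sums f z"
    and "\<And>z. z \<notin> unit_disc \<Longrightarrow> f z = 0"
  shows "f \<in> H" and "taylor f n = a n"
proof -
  obtain L where L: "L \<in> H" "\<And>n. taylor L n = a n"
    using series_mem[OF assms(1)] by blast
  have "L z = f z" if z: "z \<in> unit_disc" for z
    using taylor_sums[OF holomorphic[OF L(1)] z] assms(2)[OF z] unfolding L(2)
    by (rule sums_unique2)
  then have "L = f" by (rule H_eqI[OF L(1) _ assms(3)])
  then show "f \<in> H" "taylor f n = a n" using L by auto
qed

end

section \<open>Multiplication operators\<close>

context power_weight_space
begin

lemma mult_Schur:
  assumes f: "f \<in> H"
    and G: "\<And>z. z \<in> unit_disc \<Longrightarrow> (\<lambda>k. g k * z ^ k) sums G z"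
    and g: "summable (\<lambda>k. norm (g k))"
    and C: "\<And>m. (\<Sum>n\<le>m. norm (g (m - n)) * b n) \<le> C * b m"
  shows "(\<lambda>z. G z * f z) \<in> H"
    and "(ip_norm ip (\<lambda>z. G z * f z))\<^sup>2 \<le> C * (\<Sum>k. norm (g k)) * (ip_norm ip f)\<^sup>2"
proof -
  note conv = weighted_convolution[OF b_pos g C taylor_summable_sq[OF f]]
  have off: "G z * f z = 0" if "z \<notin> unit_disc" for z
    using vanishes[OF f that] by simp
  have mem: "(\<lambda>z. G z * f z) \<in> H"
    and taylor: "taylor (\<lambda>z. G z * f z) m = (\<Sum>n\<le>m. g (m - n) * taylor f n)" for m
    using mem_if_summable[OF conv(1) mult_series_sums[OF holomorphic[OF f] G g] off] by auto
  show "(\<lambda>z. G z * f z) \<in> H" by (rule mem)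
  show "(ip_norm ip (\<lambda>z. G z * f z))\<^sup>2 \<le> C * (\<Sum>k. norm (g k)) * (ip_norm ip f)\<^sup>2"
    using norm_sums[OF mem] norm_sums[OF f] conv(2) unfolding taylor by (simp add: sums_iff)
qed

text \<open>
  Up to a constant, a bound for the norm of the \<open>k\<close>-th power of \<open>M\<^sub>z\<close>.
\<close>

definition wt :: "nat \<Rightarrow> real" where
  "wt k = (real k + 1) powr \<bar>\<gamma>\<bar>"

lemma wt_ge_1: "wt k \<ge> 1"
  by (simp add: wt_def ge_one_powr_ge_zero)

lemma summable_geometric_wt: "\<lbrakk>0 \<le> \<rho>; \<rho> < 1\<rbrakk> \<Longrightarrow> summable (\<lambda>k. \<rho> ^ k * wt k)"
  unfolding wt_def by (rule summable_geometric_powr)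

text \<open>
  For \<open>n \<le> m\<close> the ratio \<open>b n / b m\<close> is at most a multiple of \<open>wt (m - n)\<close>, so that both conditions
  of Schur's test follow from the summability of \<open>g\<close> against \<open>wt\<close>. The bound serves for the
  resolvent and for norm convergent expansions. For the automorphisms it depends on the position of
  the zero, because their coefficients decay slowly when the zero is near the circle.
\<close>

lemma mult_wt:
  "\<exists>M>0. \<forall>g G f. f \<in> H \<longrightarrow> (\<forall>z\<in>unit_disc. (\<lambda>k. g k * z ^ k) sums G z) \<longrightarrow>
     summable (\<lambda>k. norm (g k) * wt k) \<longrightarrow>
     (\<lambda>z. G z * f z) \<in> H \<and>
     ip_norm ip (\<lambda>z. G z * f z) \<le> M * (\<Sum>k. norm (g k) * wt k) * ip_norm ip f"
proof -
  obtain C where C0: "C > 0" "\<forall>m n. n \<le> m \<longrightarrow> b n \<le> C * wt (m - n) * b m"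
    using b_ratio unfolding wt_def by blast
  then have C: "C > 0" "n \<le> m \<Longrightarrow> b n \<le> C * wt (m - n) * b m" for m n by auto
  have main: "(\<lambda>z. G z * f z) \<in> H \<and>
      ip_norm ip (\<lambda>z. G z * f z) \<le> sqrt C * (\<Sum>k. norm (g k) * wt k) * ip_norm ip f"
    if f: "f \<in> H" and G: "\<And>z. z \<in> unit_disc \<Longrightarrow> (\<lambda>k. g k * z ^ k) sums G z"
      and g: "summable (\<lambda>k. norm (g k) * wt k)" for g G f
  proof -
    define E where "E = (\<Sum>k. norm (g k) * wt k)"
    have le: "norm (g k) \<le> norm (g k) * wt k" for k
      using wt_ge_1[of k] by (simp add: mult_le_cancel_left1)
    have g1: "summable (\<lambda>k. norm (g k))"
      by (rule summable_comparison_test'[OF g, of 0]) (use le in simp)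
    have wt0: "norm (g k) * wt k \<ge> 0" for k
      using wt_ge_1[of k] by simp
    have E0: "E \<ge> 0"
      unfolding E_def by (rule suminf_nonneg[OF g wt0])
    have row: "(\<Sum>n\<le>m. norm (g (m - n)) * b n) \<le> (C * E) * b m" for m
    proof -
      have "(\<Sum>n\<le>m. norm (g (m - n)) * b n)
              \<le> (\<Sum>n\<le>m. norm (g (m - n)) * (C * wt (m - n) * b m))"
        by (intro sum_mono mult_left_mono C(2)) auto
      also have "\<dots> = C * b m * (\<Sum>n\<le>m. norm (g (m - n)) * wt (m - n))"
        by (simp add: sum_distrib_left mult_ac)
      also have "(\<Sum>n\<le>m. norm (g (m - n)) * wt (m - n)) = (\<Sum>k\<le>m. norm (g k) * wt k)"
        by (rule sum.reindex_bij_witness[of _ "\<lambda>k. m - k" "\<lambda>n. m - n"]) auto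
      also have "C * b m * \<dots> \<le> C * b m * E"
        unfolding E_def using C(1) b_pos[of m]
        by (intro mult_left_mono sum_le_suminf[OF g]) (auto intro: wt0)
      finally show ?thesis by (simp add: mult_ac)
    qed
    note S = mult_Schur[OF f G g1 row]
    have "(\<Sum>k. norm (g k)) \<le> E"
      unfolding E_def by (rule suminf_le[OF le g1 g])
    then have "C * E * (\<Sum>k. norm (g k)) * (ip_norm ip f)\<^sup>2 \<le> C * E * E * (ip_norm ip f)\<^sup>2"
      using C(1) E0 by (intro mult_right_mono mult_left_mono) (simp_all add: less_imp_le)
    with S(2) have "(ip_norm ip (\<lambda>z. G z * f z))\<^sup>2 \<le> C * E * E * (ip_norm ip f)\<^sup>2"
      by (rule order_trans)
    also have "\<dots> = (sqrt C * E * ip_norm ip f)\<^sup>2"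
    proof -
      have "(sqrt C)\<^sup>2 = C" using C(1) by simp
      then show ?thesis unfolding power_mult_distrib by (simp add: power2_eq_square[of E])
    qed
    finally have "ip_norm ip (\<lambda>z. G z * f z) \<le> sqrt C * E * ip_norm ip f"
      by (rule power2_le_imp_le) (use C(1) E0 ip_norm_nonneg[OF f] in simp)
    with S(1) show ?thesis unfolding E_def by blast
  qed
  show ?thesis
    by (intro exI[of _ "sqrt C"] conjI[of "sqrt C > 0"] allI impI main) (use C(1) in auto)
qed

lemma mult_mem:
  assumes "f \<in> H" "\<And>z. z \<in> unit_disc \<Longrightarrow> (\<lambda>k. g k * z ^ k) sums G z"
    "summable (\<lambda>k. norm (g k) * wt k)"
  shows "(\<lambda>z. G z * f z) \<in> H"
proof -
  from mult_wt obtain M where M: "\<forall>g G f. f \<in> H \<longrightarrow> (\<forall>z\<in>unit_disc. (\<lambda>k. g k * z ^ k) sums G z) \<longrightarrow>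
     summable (\<lambda>k. norm (g k) * wt k) \<longrightarrow>
     (\<lambda>z. G z * f z) \<in> H \<and>
     ip_norm ip (\<lambda>z. G z * f z) \<le> M * (\<Sum>k. norm (g k) * wt k) * ip_norm ip f"
    by auto
  show ?thesis by (rule M[rule_format, THEN conjunct1, of f g G]) (use assms in auto)
qed

lemma bounded_op_mult:
  assumes "\<And>z. z \<in> unit_disc \<Longrightarrow> (\<lambda>k. g k * z ^ k) sums G z"
    "summable (\<lambda>k. norm (g k) * wt k)"
  shows "bounded_op H ip (\<lambda>f z. G z * f z)"
proof -
  from mult_wt obtain M where M: "\<forall>g G f. f \<in> H \<longrightarrow> (\<forall>z\<in>unit_disc. (\<lambda>k. g k * z ^ k) sums G z) \<longrightarrow>
     summable (\<lambda>k. norm (g k) * wt k) \<longrightarrow>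
     (\<lambda>z. G z * f z) \<in> H \<and>
     ip_norm ip (\<lambda>z. G z * f z) \<le> M * (\<Sum>k. norm (g k) * wt k) * ip_norm ip f"
    by auto
  have "ip_norm ip (\<lambda>z. G z * f z) \<le> M * (\<Sum>k. norm (g k) * wt k) * ip_norm ip f"
    if "f \<in> H" for f
    by (rule M[rule_format, THEN conjunct2, of f g G]) (use assms that in auto)
  then have "\<exists>C. \<forall>f\<in>H. ip_norm ip (\<lambda>z. G z * f z) \<le> C * ip_norm ip f"
    by blast
  then show ?thesis
    using mult_mem[OF _ assms] by (auto simp: bounded_op_def algebra_simps)
qed

lemma power_mult_mem_norm:
  "\<exists>M>0. \<forall>k. \<forall>f\<in>H. (\<lambda>z. z ^ k * f z) \<in> H \<and>
     ip_norm ip (\<lambda>z. z ^ k * f z) \<le> M * wt k * ip_norm ip f"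
proof -
  from mult_wt obtain M where M: "M > 0" "\<forall>g G f. f \<in> H \<longrightarrow> (\<forall>z\<in>unit_disc. (\<lambda>k. g k * z ^ k) sums G z) \<longrightarrow>
     summable (\<lambda>k. norm (g k) * wt k) \<longrightarrow>
     (\<lambda>z. G z * f z) \<in> H \<and>
     ip_norm ip (\<lambda>z. G z * f z) \<le> M * (\<Sum>k. norm (g k) * wt k) * ip_norm ip f"
    by auto
  have "(\<lambda>z. z ^ k * f z) \<in> H \<and> ip_norm ip (\<lambda>z. z ^ k * f z) \<le> M * wt k * ip_norm ip f"
    if f: "f \<in> H" for k f
  proof -
    have S: "(\<lambda>i. norm (if i = k then 1 else 0 :: complex) * wt i) sums wt k"
      using sums_single[of k wt] by (rule sums_cong[THEN iffD1, rotated]) auto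
    show ?thesis
      unfolding sums_unique[OF S]
      by (rule M(2)[rule_format, OF f]) (rule powser_sums_if, rule sums_summable[OF S])
  qed
  then show ?thesis using M(1) by blast
qed

end

section \<open>Functional calculus of the multiplication operator\<close>

context power_weight_space
begin

text \<open>
  Expansions that converge in operator norm may be tested against vectors term by term.
\<close>

lemma ip_mult_sums:
  assumes f: "f \<in> H" and h: "h \<in> H"
    and G: "\<And>z. z \<in> unit_disc \<Longrightarrow> (\<lambda>k. g k * z ^ k) sums G z"
    and g: "summable (\<lambda>k. norm (g k) * wt k)"
  shows "(\<lambda>k. g k * ip (\<lambda>z. z ^ k * f z) h) sums ip (\<lambda>z. G z * f z) h"
proof -
  from mult_wt obtain M where M: "M > 0" "\<forall>g G f. f \<in> H \<longrightarrow> (\<forall>z\<in>unit_disc. (\<lambda>k. g k * z ^ k) sums G z) \<longrightarrow>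
     summable (\<lambda>k. norm (g k) * wt k) \<longrightarrow>
     (\<lambda>z. G z * f z) \<in> H \<and>
     ip_norm ip (\<lambda>z. G z * f z) \<le> M * (\<Sum>k. norm (g k) * wt k) * ip_norm ip f"
    by auto
  have pow: "(\<lambda>z. z ^ k * f z) \<in> H" for k
    using power_mult_mem_norm f by blast
  define E where "E = (\<Sum>k. norm (g k) * wt k)"
  define E' where "E' K = (\<Sum>k<K. norm (g k) * wt k)" for K
  have E': "E' \<longlonglongrightarrow> E"
    unfolding E_def E'_def using summable_LIMSEQ[OF g] .
  have bound: "norm ((\<Sum>k<K. g k * ip (\<lambda>z. z ^ k * f z) h) - ip (\<lambda>z. G z * f z) h)
                 \<le> M * (E - E' K) * ip_norm ip f * ip_norm ip h" for K
  proof -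
    define tail where "tail k = (if k < K then 0 else g k)" for k
    define P where "P z = (\<Sum>k<K. g k * z ^ k)" for z
    have fin: "(\<lambda>k. if k \<in> {..<K} then norm (g k) * wt k else 0) sums E' K"
      unfolding E'_def by (rule sums_If_finite_set) simp
    have tail_sums: "(\<lambda>k. norm (tail k) * wt k) sums (E - E' K)"
    proof -
      have "(\<lambda>k. norm (g k) * wt k - (if k \<in> {..<K} then norm (g k) * wt k else 0)) sums (E - E' K)"
        unfolding E_def by (rule sums_diff[OF summable_sums[OF g] fin])
      also have "(\<lambda>k. norm (g k) * wt k - (if k \<in> {..<K} then norm (g k) * wt k else 0))
                   = (\<lambda>k. norm (tail k) * wt k)"
        by (auto simp: tail_def)
      finally show ?thesis .
    qed
    have tail_G: "(\<lambda>k. tail k * z ^ k) sums (G z - P z)" if z: "z \<in> unit_disc" for z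
    proof -
      have "(\<lambda>k. if k \<in> {..<K} then g k * z ^ k else 0) sums P z"
        unfolding P_def by (rule sums_If_finite_set) simp
      from sums_diff[OF G[OF z] this]
      have "(\<lambda>k. g k * z ^ k - (if k \<in> {..<K} then g k * z ^ k else 0)) sums (G z - P z)" .
      also have "(\<lambda>k. g k * z ^ k - (if k \<in> {..<K} then g k * z ^ k else 0)) = (\<lambda>k. tail k * z ^ k)"
        by (auto simp: tail_def)
      finally show ?thesis .
    qed
    have "(\<lambda>z. (G z - P z) * f z) \<in> H \<and>
      ip_norm ip (\<lambda>z. (G z - P z) * f z) \<le> M * (\<Sum>k. norm (tail k) * wt k) * ip_norm ip f"
      by (rule M(2)[rule_format, OF f]) (rule tail_G, simp, rule sums_summable[OF tail_sums])
    then have T: "(\<lambda>z. (G z - P z) * f z) \<in> H"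
      "ip_norm ip (\<lambda>z. (G z - P z) * f z) \<le> M * (E - E' K) * ip_norm ip f"
      using sums_unique[OF tail_sums] by simp_all
    have Gf: "(\<lambda>z. G z * f z) \<in> H" by (rule mult_mem[OF f G g])
    have Pf: "(\<lambda>z. \<Sum>k<K. g k * (z ^ k * f z)) \<in> H"
      by (intro sum_mem scale_mem pow)
    have "(\<lambda>z. (G z - P z) * f z) = (\<lambda>z. G z * f z - (\<Sum>k<K. g k * (z ^ k * f z)))"
      by (simp add: P_def left_diff_distrib sum_distrib_right mult.assoc)
    then have "ip (\<lambda>z. (G z - P z) * f z) h
        = ip (\<lambda>z. G z * f z) h - (\<Sum>k<K. g k * ip (\<lambda>z. z ^ k * f z) h)"
      using Gf Pf h pow by (simp add: ip_diff ip_sum scale_mem ip_scale)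
    then have "norm ((\<Sum>k<K. g k * ip (\<lambda>z. z ^ k * f z) h) - ip (\<lambda>z. G z * f z) h)
        = norm (ip (\<lambda>z. (G z - P z) * f z) h)"
      by (simp add: norm_minus_commute)
    also have "\<dots> \<le> ip_norm ip (\<lambda>z. (G z - P z) * f z) * ip_norm ip h"
      by (rule Cauchy_Schwarz_ip[OF T(1) h])
    also have "\<dots> \<le> M * (E - E' K) * ip_norm ip f * ip_norm ip h"
      using T(2) ip_norm_nonneg[OF h] by (rule mult_right_mono)
    finally show ?thesis .
  qed
  have lim: "(\<lambda>K. M * (E - E' K) * ip_norm ip f * ip_norm ip h) \<longlonglongrightarrow> 0"
    using E' by (auto intro!: tendsto_eq_intros)
  have "(\<lambda>K. (\<Sum>k<K. g k * ip (\<lambda>z. z ^ k * f z) h) - ip (\<lambda>z. G z * f z) h) \<longlonglongrightarrow> 0"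
    by (rule Lim_null_comparison[OF _ lim]) (use bound in auto)
  then show ?thesis
    unfolding sums_def by (rule LIM_zero_cancel)
qed

lemma bounded_op_mult_z: "bounded_op H ip mult_z"
proof -
  have "(\<lambda>k. norm (if k = 1 then 1 else 0 :: complex) * wt k) = (\<lambda>k. if k = 1 then wt k else 0)"
    by auto
  then have "summable (\<lambda>k. norm (if k = 1 then 1 else 0 :: complex) * wt k)"
    using sums_single[of 1 wt] by (simp add: sums_iff)
  then have "bounded_op H ip (\<lambda>f z. z ^ 1 * f z)"
    by (intro bounded_op_mult[OF powser_sums_if])
  moreover have "mult_z = (\<lambda>f z. z * f z)" by (intro ext) (simp add: mult_z_def)
  ultimately show ?thesis by simp
qed

lemma resolvent_series:
  assumes c: "norm c > 1"
  shows "z \<in> unit_disc \<Longrightarrow> (\<lambda>k. inverse (c ^ Suc k) * z ^ k) sums inverse (c - z)"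
    and "summable (\<lambda>k. norm (inverse (c ^ Suc k)) * wt k)"
proof -
  have c0: "c \<noteq> 0" using c by auto
  show "(\<lambda>k. inverse (c ^ Suc k) * z ^ k) sums inverse (c - z)" if z: "z \<in> unit_disc"
  proof -
    have "norm (z / c) < 1"
      using c z by (simp add: norm_divide divide_simps)
    from sums_mult[OF geometric_sums[OF this], of "inverse c"]
    have "(\<lambda>k. inverse c * (z / c) ^ k) sums (inverse c * (1 / (1 - z / c)))" .
    moreover have "inverse c * (1 / (1 - z / c)) = inverse (c - z)"
      using c0 c z by (auto simp: field_simps)
    moreover have "inverse c * (z / c) ^ k = inverse (c ^ Suc k) * z ^ k" for k
      using c0 by (simp add: field_simps)
    ultimately show ?thesis by simp
  qed
  have "summable (\<lambda>k. inverse (norm c) * (inverse (norm c) ^ k * wt k))"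
    using c by (intro summable_mult summable_geometric_wt) (auto simp: inverse_less_1_iff)
  then show "summable (\<lambda>k. norm (inverse (c ^ Suc k)) * wt k)"
    by (simp add: norm_inverse norm_power power_inverse norm_mult mult_ac)
qed

lemma resolvent_outside:
  assumes c: "norm c > 1"
  shows "c \<notin> op_spectrum H ip mult_z"
    and "f \<in> H \<Longrightarrow> resolvent H mult_z c f = (\<lambda>z. inverse (c - z) * f z)"
proof -
  define A where "A = (\<lambda>f x. c * f x - mult_z f x)"
  define R where "R f = (\<lambda>z. inverse (c - z) * f z)" for f :: "complex \<Rightarrow> complex"
  have bR: "bounded_op H ip R"
    unfolding R_def by (rule bounded_op_mult[OF resolvent_series[OF c]])
  have cz: "c - z \<noteq> 0" if "z \<in> unit_disc" for z
    using c that by auto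
  have A_mem: "A f \<in> H" if "f \<in> H" for f
    unfolding A_def using that bounded_op_mult_z
    by (intro diff_mem scale_mem) (auto simp: bounded_op_def)
  have R_mem: "R f \<in> H" if "f \<in> H" for f
    using bR that by (auto simp: bounded_op_def)
  have RA: "R (A f) = f" if f: "f \<in> H" for f
  proof
    fix z
    have "A f z = (c - z) * f z" by (simp add: A_def mult_z_def left_diff_distrib)
    then show "R (A f) z = f z"
      using cz[of z] vanishes[OF f, of z] by (cases "z \<in> unit_disc") (simp_all add: R_def)
  qed
  have AR: "A (R f) = f" if f: "f \<in> H" for f
  proof
    fix z
    have "A (R f) z = (c - z) * R f z" by (simp add: A_def mult_z_def left_diff_distrib)
    then show "A (R f) z = f z"
      using cz[of z] vanishes[OF f, of z] by (cases "z \<in> unit_disc") (simp_all add: R_def)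
  qed
  have bij: "bij_betw A H H"
    by (rule bij_betw_byWitness[where f' = R]) (use RA AR A_mem R_mem in auto)
  have res: "resolvent H mult_z c f = R f" if f: "f \<in> H" for f
    unfolding resolvent_def A_def[symmetric]
    by (rule inv_into_f_eq[of A H "R f" f]) (rule bij_betw_imp_inj_on[OF bij] R_mem[OF f] AR[OF f])+
  show "f \<in> H \<Longrightarrow> resolvent H mult_z c f = (\<lambda>z. inverse (c - z) * f z)"
    using res by (simp add: R_def)
  have "bounded_op H ip (resolvent H mult_z c)"
    using bR by (simp add: bounded_op_def res add_mem scale_mem)
  then show "c \<notin> op_spectrum H ip mult_z"
    using bij by (simp add: op_spectrum_def A_def)
qed

lemma spectrum_subset_cball: "op_spectrum H ip mult_z \<subseteq> cball 0 1"
  using resolvent_outside(1) by (intro subsetI) (force simp: not_le)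

lemma resolvent_apply:
  assumes c: "c \<notin> op_spectrum H ip mult_z" and f: "f \<in> H"
  shows "resolvent H mult_z c f \<in> H" and "(c - z) * resolvent H mult_z c f z = f z"
proof -
  define A where "A = (\<lambda>f x. c * f x - mult_z f x)"
  have bij: "bij_betw A H H"
    using c by (simp add: op_spectrum_def A_def)
  have fA: "f \<in> A ` H" using f bij by (simp add: bij_betw_def)
  have R: "resolvent H mult_z c f = inv_into H A f"
    by (simp add: resolvent_def A_def)
  show "resolvent H mult_z c f \<in> H"
    unfolding R by (rule inv_into_into[OF fA])
  have "A (resolvent H mult_z c f) z = f z"
    unfolding R using f_inv_into_f[OF fA] by simp
  then show "(c - z) * resolvent H mult_z c f z = f z"
    by (simp add: A_def mult_z_def algebra_simps)
qed

text \<open>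
  If \<open>\<bar>c\<bar> < 1\<close>, every function in the range of \<open>c - M\<^sub>z\<close> vanishes at \<open>c\<close>, but \<open>1\<close> does not.
\<close>

lemma disc_subset_spectrum: "unit_disc \<subseteq> op_spectrum H ip mult_z"
proof
  fix c :: complex assume c: "c \<in> unit_disc"
  show "c \<in> op_spectrum H ip mult_z"
  proof (rule ccontr)
    assume "c \<notin> op_spectrum H ip mult_z"
    from resolvent_apply(2)[OF this monomial_mem[of 0], of c] show False
      using c by (simp add: monomial_def)
  qed
qed

text \<open>
  On a circle outside the closed disc the resolvent is the Neumann series of the powers of \<open>M\<^sub>z\<close>,
  uniformly. Integrating it against \<open>\<psi>\<close> term by term yields the Taylor coefficients of \<open>\<psi>\<close>, and
  the series of these coefficients with the powers of \<open>M\<^sub>z\<close> is multiplication by \<open>\<psi>\<close>.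
\<close>

lemma calculus_mult:
  assumes R: "R > 1" and hol: "\<psi> holomorphic_on ball 0 R"
  shows "holomorphic_calculus H ip mult_z (ball 0 R) \<psi> (\<lambda>f z. \<psi> z * f z)"
proof -
  (* r is the radius of the cycle; \<rho> leaves room for geometric decay of the coefficients of \<psi> *)
  obtain \<rho> where \<rho>: "1 < \<rho>" "\<rho> < R" using dense[OF R] by blast
  obtain r where r: "1 < r" "r < \<rho>" using dense[OF \<rho>(1)] by blast
  have series: "(\<lambda>k. taylor \<psi> k * z ^ k) sums \<psi> z" if "norm z < R" for z
    using holomorphic_power_series[OF hol, of z] that by (simp add: taylor_def)
  have disc: "(\<lambda>k. taylor \<psi> k * z ^ k) sums \<psi> z" if "z \<in> unit_disc" for z
    using that R by (intro series) auto
  have wt_summable: "summable (\<lambda>k. norm (taylor \<psi> k) * wt k)"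
  proof -
    have "(\<lambda>k. taylor \<psi> k * of_real \<rho> ^ k) \<longlonglongrightarrow> 0"
      using series[of "of_real \<rho>"] \<rho> by (intro summable_LIMSEQ_zero sums_summable) auto
    then have "Bseq (\<lambda>k. taylor \<psi> k * of_real \<rho> ^ k)"
      by (intro convergent_imp_Bseq convergentI)
    then obtain B where B: "\<forall>k. norm (taylor \<psi> k * of_real \<rho> ^ k) \<le> B"
      by (auto simp: Bseq_def)
    have le: "norm (norm (taylor \<psi> k) * wt k) \<le> B * (inverse \<rho> ^ k * wt k)" for k
    proof -
      have "norm (taylor \<psi> k) \<le> B * inverse \<rho> ^ k"
        using B[rule_format, of k] \<rho> by (simp add: norm_mult norm_power power_inverse field_simps)
      from mult_right_mono[OF this, of "wt k"] show ?thesis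
        using wt_ge_1[of k] by (simp add: mult_ac)
    qed
    have "summable (\<lambda>k. B * (inverse \<rho> ^ k * wt k))"
      using \<rho> by (intro summable_mult summable_geometric_wt) (auto simp: inverse_less_1_iff)
    then show ?thesis by (rule summable_comparison_test'[of _ 0]) (rule le)
  qed
  have r_circle: "sphere 0 r \<subseteq> ball 0 R - op_spectrum H ip mult_z"
    using spectrum_subset_cball r \<rho> by auto
  have integral: "ip (\<lambda>z. \<psi> z * f z) h =
      1 / (2 * of_real pi * \<i>) *
      contour_integral (circlepath 0 r) (\<lambda>c. \<psi> c * ip (resolvent H mult_z c f) h)"
    if f: "f \<in> H" and h: "h \<in> H" for f h
  proof -
    define t where "t k = ip (\<lambda>z. z ^ k * f z) h" for k
    define summand where "summand k c = \<psi> c * (inverse (c ^ Suc k) * t k)" for k c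
    obtain M where M: "M > 0" "\<forall>k. \<forall>f\<in>H. (\<lambda>z. z ^ k * f z) \<in> H \<and>
        ip_norm ip (\<lambda>z. z ^ k * f z) \<le> M * wt k * ip_norm ip f"
      using power_mult_mem_norm by blast
    have t_le: "norm (t k) \<le> (M * ip_norm ip f * ip_norm ip h) * wt k" for k
    proof -
      have "norm (t k) \<le> ip_norm ip (\<lambda>z. z ^ k * f z) * ip_norm ip h"
        unfolding t_def using M(2) f h by (intro Cauchy_Schwarz_ip) auto
      also have "\<dots> \<le> (M * wt k * ip_norm ip f) * ip_norm ip h"
        using M(2) f ip_norm_nonneg[OF h] by (intro mult_right_mono) auto
      finally show ?thesis by (simp add: mult_ac)
    qed
    have cont: "continuous_on (cball 0 r) \<psi>"
      using r \<rho> by (intro holomorphic_on_imp_continuous_on holomorphic_on_subset[OF hol]) auto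
    have "bounded (\<psi> ` sphere 0 r)"
      by (intro compact_imp_bounded compact_continuous_image continuous_on_subset[OF cont]) auto
    then obtain B where B: "\<forall>c\<in>sphere 0 r. norm (\<psi> c) \<le> B"
      unfolding bounded_iff by blast
    have pointwise: "(\<lambda>k. summand k c) sums (\<psi> c * ip (resolvent H mult_z c f) h)"
      if c: "c \<in> sphere 0 r" for c
    proof -
      have c1: "norm c > 1" using c r by simp
      show ?thesis
        unfolding summand_def t_def resolvent_outside(2)[OF c1 f]
        by (rule sums_mult[OF ip_mult_sums[OF f h resolvent_series[OF c1]]])
    qed
    define N where "N k = B * (inverse r * (M * ip_norm ip f * ip_norm ip h)) * (inverse r ^ k * wt k)" for k
    have "uniform_limit (sphere 0 r) (\<lambda>n c. \<Sum>k<n. summand k c) (\<lambda>c. \<Sum>k. summand k c) sequentially"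
    proof (rule Weierstrass_m_test)
      fix k c assume c: "c \<in> sphere (0::complex) r"
      have "norm (summand k c) = norm (\<psi> c) * ((inverse r * inverse r ^ k) * norm (t k))"
        using c r by (simp add: summand_def norm_mult norm_inverse norm_power power_inverse)
      also have "\<dots> \<le> B * ((inverse r * inverse r ^ k) * ((M * ip_norm ip f * ip_norm ip h) * wt k))"
        using B[rule_format, OF c] order_trans[OF norm_ge_zero B[rule_format, OF c]] r t_le[of k]
        by (intro mult_mono mult_left_mono) auto
      finally show "norm (summand k c) \<le> N k" by (simp add: N_def mult_ac)
    next
      show "summable N"
        unfolding N_def using r
        by (intro summable_mult summable_geometric_wt) (auto simp: inverse_less_1_iff)
    qed
    also have "?this \<longleftrightarrow> uniform_limit (sphere 0 r) (\<lambda>n c. \<Sum>k<n. summand k c)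
        (\<lambda>c. \<psi> c * ip (resolvent H mult_z c f) h) sequentially"
      by (intro uniform_limit_cong') (use pointwise in \<open>auto simp: sums_iff\<close>)
    finally have unif: "uniform_limit (sphere 0 r) (\<lambda>n c. \<Sum>k<n. summand k c)
        (\<lambda>c. \<psi> c * ip (resolvent H mult_z c f) h) sequentially" .
    have has_int: "(summand k has_contour_integral (2 * of_real pi * \<i> * (taylor \<psi> k * t k))) (circlepath 0 r)" for k
    proof -
      have "((\<lambda>u. \<psi> u / (u - 0) ^ Suc k) has_contour_integral
              (of_real (2 * pi) * \<i> / fact k * (deriv ^^ k) \<psi> 0)) (circlepath 0 r)"
        using cont r \<rho> 
        by (intro Cauchy_has_contour_integral_higher_derivative_circlepath holomorphic_on_subset[OF hol]) auto
      from has_contour_integral_lmul[OF this, of "t k"] show ?thesis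
        by (simp add: summand_def[abs_def] taylor_def field_simps)
    qed
    have sum_int: "((\<lambda>c. \<Sum>k<n. summand k c) has_contour_integral
        (\<Sum>k<n. 2 * of_real pi * \<i> * (taylor \<psi> k * t k))) (circlepath 0 r)" for n
      by (intro has_contour_integral_sum has_int) auto
    have "(\<lambda>n. contour_integral (circlepath 0 r) (\<lambda>c. \<Sum>k<n. summand k c)) \<longlonglongrightarrow>
        contour_integral (circlepath 0 r) (\<lambda>c. \<psi> c * ip (resolvent H mult_z c f) h)"
      by (rule contour_integral_uniform_limit_circlepath(2)[OF _ unif])
        (use sum_int r in \<open>auto intro!: always_eventually has_contour_integral_integrable\<close>)
    then have "(\<lambda>k. 2 * of_real pi * \<i> * (taylor \<psi> k * t k)) sums
        contour_integral (circlepath 0 r) (\<lambda>c. \<psi> c * ip (resolvent H mult_z c f) h)"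
      unfolding contour_integral_unique[OF sum_int] sums_def .
    moreover have "(\<lambda>k. 2 * of_real pi * \<i> * (taylor \<psi> k * t k)) sums
        (2 * of_real pi * \<i> * ip (\<lambda>z. \<psi> z * f z) h)"
      unfolding t_def by (rule sums_mult[OF ip_mult_sums[OF f h disc wt_summable]])
    ultimately have "contour_integral (circlepath 0 r) (\<lambda>c. \<psi> c * ip (resolvent H mult_z c f) h)
        = 2 * of_real pi * \<i> * ip (\<lambda>z. \<psi> z * f z) h"
      by (rule sums_unique2)
    then show ?thesis by simp
  qed
  have wind1: "winding_number (circlepath 0 r) c = 1" if "c \<in> op_spectrum H ip mult_z" for c
    using that spectrum_subset_cball r by (intro winding_number_circlepath) auto
  have wind0: "winding_number (circlepath 0 r) c = 0" if "c \<notin> ball 0 R" for c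
    using that r \<rho> by (intro winding_number_zero_outside[of _ "cball 0 r"]) auto
  show ?thesis
    unfolding holomorphic_calculus_def
  proof (intro conjI exI[of _ "[circlepath 0 r]"])
    show "op_spectrum H ip mult_z \<subseteq> ball 0 R"
      using spectrum_subset_cball R by auto
    show "bounded_op H ip (\<lambda>f z. \<psi> z * f z)"
      by (rule bounded_op_mult[OF disc wt_summable])
  qed (use hol integral wind1 wind0 r_circle r in auto)
qed

end

section \<open>Automorphisms of the disc\<close>

text \<open>
  After moving the zero of \<open>\<phi>\<close> to the origin, both the map and its inverse satisfy the hypotheses of
  the Schwarz lemma. Hence it preserves absolute values, which makes it a rotation.
\<close>

lemma Moeb_form:
  assumes "\<phi> \<in> Moeb"
  shows "\<exists>u a. norm u = 1 \<and> norm a < 1 \<and> (\<forall>z\<in>unit_disc. \<phi> z = u * (z - a) / (1 - cnj a * z))"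
proof -
  define \<eta> where "\<eta> = inv_into unit_disc \<phi>"
  have bij: "bij_betw \<phi> unit_disc unit_disc" and hol: "\<phi> holomorphic_on unit_disc"
    and hol': "\<eta> holomorphic_on unit_disc"
    using assms by (auto simp: Moeb_def \<eta>_def)
  have \<phi>_norm: "norm (\<phi> z) < 1" if "norm z < 1" for z
    using bij_betwE[OF bij] that by auto
  have \<eta>_norm: "norm (\<eta> z) < 1" and \<phi>\<eta>: "\<phi> (\<eta> z) = z" and \<eta>\<phi>: "\<eta> (\<phi> z) = z" if "norm z < 1" for z
  proof -
    have "z \<in> \<phi> ` unit_disc" using bij that by (simp add: bij_betw_def)
    then show "norm (\<eta> z) < 1" "\<phi> (\<eta> z) = z"
      using inv_into_into[of z \<phi> unit_disc] f_inv_into_f[of z \<phi> unit_disc] by (simp_all add: \<eta>_def)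
    show "\<eta> (\<phi> z) = z"
      unfolding \<eta>_def using that by (intro inv_into_f_f bij_betw_imp_inj_on[OF bij]) auto
  qed
  define a where "a = \<eta> 0"
  have a: "norm a < 1" "\<phi> a = 0" using \<eta>_norm[of 0] \<phi>\<eta>[of 0] by (auto simp: a_def)
  define F where "F z = \<phi> (Moebius_function 0 (-a) z)" for z
  define G where "G z = Moebius_function 0 a (\<eta> z)" for z
  have M_norm: "norm (Moebius_function 0 (-a) z) < 1" "norm (Moebius_function 0 a z) < 1"
    if "norm z < 1" for z
    using Moebius_function_norm_lt_1[of "-a" z] Moebius_function_norm_lt_1[of a z] a that by auto
  have F_hol: "F holomorphic_on unit_disc"
    unfolding F_def using Moebius_function_holomorphic[of "-a"] a M_norm
    by (intro holomorphic_on_compose_gen[OF _ hol, unfolded o_def]) auto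
  have G_hol: "G holomorphic_on unit_disc"
    unfolding G_def using Moebius_function_holomorphic[of a] a \<eta>_norm
    by (intro holomorphic_on_compose_gen[OF hol', unfolded o_def]) auto
  have F0: "F 0 = 0" using a by (simp add: F_def Moebius_function_of_zero)
  have G0: "G 0 = 0" by (simp add: G_def flip: a_def) (simp add: Moebius_function_eq_zero)
  have F_norm: "norm (F z) < 1" and G_norm: "norm (G z) < 1" if "norm z < 1" for z
    using M_norm \<phi>_norm \<eta>_norm that by (auto simp: F_def G_def)
  have GF: "G (F z) = z" if "norm z < 1" for z
    using that M_norm \<eta>\<phi> Moebius_function_compose[of a "-a" z] a by (simp add: F_def G_def)
  have half: "norm (1 / 2 :: complex) < 1" by (simp add: norm_divide)
  have "norm (F (1 / 2)) = norm (1 / 2 :: complex)"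
  proof (rule antisym)
    show "norm (F (1 / 2)) \<le> norm (1 / 2 :: complex)"
      by (rule Schwarz_Lemma(1)[OF F_hol F0 F_norm half])
    have "norm (G (F (1 / 2))) \<le> norm (F (1 / 2))"
      by (rule Schwarz_Lemma(1)[OF G_hol G0 G_norm F_norm[OF half]])
    then show "norm (1 / 2 :: complex) \<le> norm (F (1 / 2))"
      using GF[OF half] by simp
  qed
  then have "\<exists>z. norm z < 1 \<and> z \<noteq> 0 \<and> norm (F z) = norm z"
    using half by (intro exI[of _ "1 / 2"]) simp
  then obtain u where u: "\<forall>z. norm z < 1 \<longrightarrow> F z = u * z" "norm u = 1"
    using Schwarz_Lemma(3)[OF F_hol F0 F_norm half] by blast
  have "\<phi> z = u * (z - a) / (1 - cnj a * z)" if z: "z \<in> unit_disc" for z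
  proof -
    have "\<phi> z = F (Moebius_function 0 a z)"
      using z a Moebius_function_compose[of "-a" a z] by (simp add: F_def)
    also have "\<dots> = u * Moebius_function 0 a z"
      using u(1) M_norm(2) z by simp
    finally show ?thesis by (simp add: Moebius_function_simple)
  qed
  then show ?thesis using u(2) a(1) by blast
qed

lemma Moebius_function_in_Moeb:
  assumes a: "norm a < 1"
  shows "Moebius_function 0 a \<in> Moeb"
proof -
  have M: "Moebius_function 0 w z \<in> unit_disc" if "norm w < 1" "z \<in> unit_disc" for w z
    using Moebius_function_norm_lt_1 that by auto
  have inv1: "Moebius_function 0 (-a) (Moebius_function 0 a z) = z"
    and inv2: "Moebius_function 0 a (Moebius_function 0 (-a) z) = z" if "z \<in> unit_disc" for z
    using Moebius_function_compose[of "-a" a z] Moebius_function_compose[of a "-a" z] a that by auto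
  have bij: "bij_betw (Moebius_function 0 a) unit_disc unit_disc"
    by (rule bij_betw_byWitness[where f' = "Moebius_function 0 (-a)"]) (use inv1 inv2 M a in auto)
  have inv: "Moebius_function 0 (-a) z = inv_into unit_disc (Moebius_function 0 a) z"
    if z: "z \<in> unit_disc" for z
    by (rule sym, rule inv_into_f_eq[OF bij_betw_imp_inj_on[OF bij]]) (use z inv2 M a in auto)
  have "norm (-a) < 1" using a by simp
  from holomorphic_transform[OF Moebius_function_holomorphic[OF this] inv]
  have "inv_into unit_disc (Moebius_function 0 a) holomorphic_on unit_disc" .
  then show ?thesis
    using bij Moebius_function_holomorphic[OF a] by (simp add: Moeb_def)
qed

definition Moebius_coeff :: "complex \<Rightarrow> complex \<Rightarrow> nat \<Rightarrow> complex" where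
  "Moebius_coeff u a k =
     (if k = 0 then - (u * a) else u * of_real (1 - (norm a)\<^sup>2) * cnj a ^ (k - 1))"

lemma norm_Moebius_coeff:
  assumes "norm u = 1" "norm a < 1"
  shows "norm (Moebius_coeff u a k) = Moebius_weight (norm a) k"
proof -
  have "(norm a)\<^sup>2 \<le> 1" using assms by (simp add: power_le_one)
  then have "norm (of_real (1 - (norm a)\<^sup>2) :: complex) = 1 - (norm a)\<^sup>2"
    unfolding norm_of_real by simp
  then show ?thesis
    using assms by (simp add: Moebius_coeff_def Moebius_weight_def norm_mult norm_power del: of_real_diff)
qed

lemma Moebius_coeff_sums:
  assumes a: "norm a < 1" and z: "z \<in> unit_disc"
  shows "(\<lambda>k. Moebius_coeff u a k * z ^ k) sums (u * (z - a) / (1 - cnj a * z))"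
proof -
  have az: "norm (cnj a * z) < 1"
    using a z mult_strict_mono'[of "norm a" 1 "norm z" 1] by (simp add: norm_mult)
  then have nz: "1 - cnj a * z \<noteq> 0" by auto
  from sums_mult[OF geometric_sums[OF az], of "u * of_real (1 - (norm a)\<^sup>2) * z"]
  have "(\<lambda>k. Moebius_coeff u a (Suc k) * z ^ Suc k) sums
          (u * of_real (1 - (norm a)\<^sup>2) * z * (1 / (1 - cnj a * z)))"
    by (simp add: Moebius_coeff_def power_mult_distrib mult_ac)
  then have "(\<lambda>k. Moebius_coeff u a k * z ^ k) sums
          (u * of_real (1 - (norm a)\<^sup>2) * z * (1 / (1 - cnj a * z)) - u * a)"
    by (subst (asm) sums_Suc_iff) (simp add: Moebius_coeff_def)
  also have "u * of_real (1 - (norm a)\<^sup>2) * z * (1 / (1 - cnj a * z)) - u * a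
               = u * (z - a) / (1 - cnj a * z)"
  proof -
    have "of_real ((norm a)\<^sup>2) = a * cnj a" by (rule complex_norm_square)
    then have "u * of_real (1 - (norm a)\<^sup>2) * z - u * a * (1 - cnj a * z) = u * (z - a)"
      by (simp add: algebra_simps)
    then show ?thesis using nz by (simp add: divide_simps)
  qed
  finally show ?thesis .
qed

section \<open>Moebius boundedness above the exponent -1\<close>

context power_weight_space
begin

lemma Moebius_mult_bound:
  assumes \<gamma>: "\<gamma> > -1"
  shows "\<exists>C\<ge>0. \<forall>u a. norm u = 1 \<longrightarrow> norm a < 1 \<longrightarrow> (\<forall>f\<in>H.
           ip_norm ip (\<lambda>z. u * (z - a) / (1 - cnj a * z) * f z) \<le> C * ip_norm ip f)"
proof -
  obtain c1 c2 where c12: "c1 > 0" "c2 > 0"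
    "\<forall>n. c1 * (real n + 1) powr \<gamma> \<le> b n \<and> b n \<le> c2 * (real n + 1) powr \<gamma>"
    using b_comparable unfolding comparable_def by blast
  then have c: "c1 > 0" "c2 > 0" "c1 * (real n + 1) powr \<gamma> \<le> b n"
    "b n \<le> c2 * (real n + 1) powr \<gamma>" for n by auto
  obtain D where D: "D > 0" "\<forall>t m. 0 \<le> t \<longrightarrow> t < 1 \<longrightarrow>
    (\<Sum>n\<le>m. Moebius_weight t (m - n) * (real n + 1) powr \<gamma>) \<le> D * (real m + 1) powr \<gamma>"
    using Moebius_weight_Schur[OF \<gamma>] by blast
  define C where "C = sqrt (c2 * D / c1 * 3)"
  have "ip_norm ip (\<lambda>z. u * (z - a) / (1 - cnj a * z) * f z) \<le> C * ip_norm ip f"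
    if u: "norm u = 1" and a: "norm a < 1" and f: "f \<in> H" for u a f
  proof -
    note nrm = norm_Moebius_coeff[OF u a]
    have W: "Moebius_weight (norm a) sums (1 + 2 * norm a)"
      by (rule Moebius_weight_sums) (use a in auto)
    have W0: "Moebius_weight (norm a) k \<ge> 0" for k
      by (rule Moebius_weight_nonneg) (use a in auto)
    have row: "(\<Sum>n\<le>m. norm (Moebius_coeff u a (m - n)) * b n) \<le> (c2 * D / c1) * b m" for m
    proof -
      have "(\<Sum>n\<le>m. norm (Moebius_coeff u a (m - n)) * b n)
              \<le> (\<Sum>n\<le>m. Moebius_weight (norm a) (m - n) * (c2 * (real n + 1) powr \<gamma>))"
        unfolding nrm by (intro sum_mono mult_left_mono c(4) W0)
      also have "\<dots> = c2 * (\<Sum>n\<le>m. Moebius_weight (norm a) (m - n) * (real n + 1) powr \<gamma>)"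
        by (simp add: sum_distrib_left mult_ac)
      also have "\<dots> \<le> c2 * (D * (real m + 1) powr \<gamma>)"
        using c(2) a by (intro mult_left_mono D(2)[rule_format]) auto
      also have "\<dots> \<le> c2 * (D * (b m / c1))"
      proof (intro mult_left_mono)
        show "(real m + 1) powr \<gamma> \<le> b m / c1"
          using c(1) c(3)[of m] by (simp add: pos_le_divide_eq mult.commute)
      qed (use c(2) D(1) in auto)
      finally show ?thesis by simp
    qed
    have "(ip_norm ip (\<lambda>z. u * (z - a) / (1 - cnj a * z) * f z))\<^sup>2
            \<le> (c2 * D / c1) * (\<Sum>k. norm (Moebius_coeff u a k)) * (ip_norm ip f)\<^sup>2"
      by (rule mult_Schur(2)[OF f Moebius_coeff_sums[OF a] _ row])
        (use W in \<open>auto simp: nrm sums_iff\<close>)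
    also have "\<dots> \<le> (c2 * D / c1) * 3 * (ip_norm ip f)\<^sup>2"
    proof (intro mult_right_mono mult_left_mono)
      show "(\<Sum>k. norm (Moebius_coeff u a k)) \<le> 3"
        using sums_unique[OF W] a by (simp add: nrm)
    qed (use c D in auto)
    also have "\<dots> = (C * ip_norm ip f)\<^sup>2"
      unfolding C_def power_mult_distrib using c(1,2) D(1) by (subst real_sqrt_pow2) auto
    finally show ?thesis
      by (rule power2_le_imp_le) (use c(1,2) D(1) ip_norm_nonneg[OF f] in \<open>simp add: C_def\<close>)
  qed
  moreover have "C \<ge> 0" using c(1,2) D(1) by (simp add: C_def)
  ultimately show ?thesis by blast
qed

text \<open>
  The pole \<open>1 / cnj a\<close> of the automorphism lies outside the closed disc, so that a slightly larger
  disc is available as the domain of the calculus.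
\<close>

lemma Moeb_calculus_mult:
  assumes a: "norm a < 1"
    and \<phi>: "\<And>z. z \<in> unit_disc \<Longrightarrow> \<phi> z = u * (z - a) / (1 - cnj a * z)"
  shows "Moeb_calculus H ip mult_z \<phi> (\<lambda>f z. u * (z - a) / (1 - cnj a * z) * f z)"
proof -
  (* any radius between 1 and 1 / norm a would do; this choice includes the case a = 0 *)
  define R where "R = 2 / (1 + norm a)"
  have den: "1 + norm a > 0" using norm_ge_zero[of a] by linarith
  have R: "R > 1" using a den by (simp add: R_def)
  have aR: "norm a * R < 1" using a den by (simp add: R_def)
  have nz: "1 - cnj a * z \<noteq> 0" if z: "z \<in> ball 0 R" for z
  proof -
    have "norm (cnj a * z) \<le> norm a * R"
      using z by (auto simp: norm_mult intro!: mult_left_mono)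
    then have "norm (cnj a * z) < 1" using aR by linarith
    then show ?thesis by auto
  qed
  have hol: "(\<lambda>z. u * (z - a) / (1 - cnj a * z)) holomorphic_on ball 0 R"
    using nz by (intro holomorphic_intros) auto
  show ?thesis
    unfolding Moeb_calculus_def
  proof (intro exI conjI)
    show "connected (ball (0::complex) R)" by (rule connected_ball)
    show "cball 0 1 \<subseteq> ball (0::complex) R" using R by auto
    show "\<forall>z\<in>unit_disc. u * (z - a) / (1 - cnj a * z) = \<phi> z" using \<phi> by simp
    show "holomorphic_calculus H ip mult_z (ball 0 R) (\<lambda>z. u * (z - a) / (1 - cnj a * z))
            (\<lambda>f z. u * (z - a) / (1 - cnj a * z) * f z)"
      by (rule calculus_mult[OF R hol])
  qed
qed

lemma Moebius_bounded_mult_z: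
  assumes \<gamma>: "\<gamma> > -1"
  shows "Moebius_bounded H ip mult_z"
proof -
  obtain C where C: "C \<ge> 0" "\<forall>u a. norm u = 1 \<longrightarrow> norm a < 1 \<longrightarrow> (\<forall>f\<in>H.
           ip_norm ip (\<lambda>z. u * (z - a) / (1 - cnj a * z) * f z) \<le> C * ip_norm ip f)"
    using Moebius_mult_bound[OF \<gamma>] by blast
  have "\<exists>S. Moeb_calculus H ip mult_z \<phi> S \<and> op_norm H ip S \<le> C" if "\<phi> \<in> Moeb" for \<phi>
  proof -
    obtain u a where u: "norm u = 1" and a: "norm a < 1"
      and \<phi>: "\<forall>z\<in>unit_disc. \<phi> z = u * (z - a) / (1 - cnj a * z)"
      using Moeb_form[OF \<open>\<phi> \<in> Moeb\<close>] by blast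
    define S where "S f = (\<lambda>z. u * (z - a) / (1 - cnj a * z) * f z)" for f :: "complex \<Rightarrow> complex"
    have "op_norm H ip S \<le> C"
      unfolding op_norm_def
    proof (rule cSUP_least)
      show "{f \<in> H. ip_norm ip f \<le> 1} \<noteq> {}"
        using zero_mem ip_norm_zero by force
      fix f assume "f \<in> {f \<in> H. ip_norm ip f \<le> 1}"
      then have f: "f \<in> H" "ip_norm ip f \<le> 1" by auto
      have "ip_norm ip (S f) \<le> C * ip_norm ip f"
        unfolding S_def using C(2) u a f(1) by blast
      also have "\<dots> \<le> C * 1" by (rule mult_left_mono[OF f(2) C(1)])
      finally show "ip_norm ip (S f) \<le> C" by simp
    qed
    moreover have "Moeb_calculus H ip mult_z \<phi> S"
      unfolding S_def[abs_def] by (rule Moeb_calculus_mult[OF a \<phi>[rule_format]])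
    ultimately show ?thesis by blast
  qed
  then show ?thesis
    unfolding Moebius_bounded_def using bounded_op_mult_z spectrum_subset_cball by blast
qed

end

section \<open>Failure of Moebius boundedness up to the exponent -1\<close>

context power_weight_space
begin

text \<open>
  For an automorphism \<open>\<phi>\<close> that has a pole, that is, whose zero is not the origin, the domain and the
  cycle in the definition of \<open>\<phi>(M\<^sub>z)\<close> do not matter. Testing against the kernel at \<open>w\<close> turns the resolvent into \<open>f w / (c - w)\<close>,
  and the partial fractions of \<open>\<phi> c / (c - w)\<close> reduce the integral to the winding numbers of the
  cycle about \<open>w\<close>, which is in the spectrum, and about the pole of \<open>\<phi>\<close>, which is not in the domain.
\<close>

lemma Moeb_calculus_unique:
  assumes a: "a \<noteq> 0" "norm a < 1"
    and S: "Moeb_calculus H ip mult_z (Moebius_function 0 a) S" and f: "f \<in> H"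
  shows "bounded_op H ip S" and "S f = (\<lambda>z. Moebius_function 0 a z * f z)"
proof -
  obtain U \<psi> where U: "connected U" "cball 0 1 \<subseteq> U"
    and \<psi>: "\<forall>z\<in>unit_disc. \<psi> z = Moebius_function 0 a z"
    and calc: "holomorphic_calculus H ip mult_z U \<psi> S"
    using S unfolding Moeb_calculus_def by blast
  from calc obtain \<Gamma> where "open U" and hol: "\<psi> holomorphic_on U" and bS: "bounded_op H ip S"
    and \<Gamma>: "\<forall>p\<in>set \<Gamma>. valid_path p \<and> pathfinish p = pathstart p \<and>
                    path_image p \<subseteq> U - op_spectrum H ip mult_z"
    and wind1: "\<forall>c\<in>op_spectrum H ip mult_z. (\<Sum>p\<leftarrow>\<Gamma>. winding_number p c) = 1"
    and wind0: "\<forall>c. c \<notin> U \<longrightarrow> (\<Sum>p\<leftarrow>\<Gamma>. winding_number p c) = 0"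
    and coeffs: "\<forall>g\<in>H. \<forall>h\<in>H. ip (S g) h = 1 / (2 * of_real pi * \<i>) *
               (\<Sum>p\<leftarrow>\<Gamma>. contour_integral p (\<lambda>c. \<psi> c * ip (resolvent H mult_z c g) h))"
    unfolding holomorphic_calculus_def by blast
  show "bounded_op H ip S" by (rule bS)
  (* the pole of the automorphism *)
  define q where "q = 1 / cnj a"
  have disc_nz: "1 - cnj a * z \<noteq> 0" if "z \<in> unit_disc" for z
  proof -
    have "norm (cnj a * z) < 1"
      using a(2) that mult_strict_mono'[of "norm a" 1 "norm z" 1] by (simp add: norm_mult)
    then show ?thesis by auto
  qed
  have \<psi>_eq: "\<psi> c * (1 - cnj a * c) = c - a" if "c \<in> U" for c
  proof (rule analytic_continuation_open[of unit_disc U "\<lambda>c. \<psi> c * (1 - cnj a * c)" "\<lambda>c. c - a"])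
    show "unit_disc \<subseteq> U" using U(2) by auto
    show "(\<lambda>c. \<psi> c * (1 - cnj a * c)) holomorphic_on U" using hol by (intro holomorphic_intros)
    show "\<psi> c * (1 - cnj a * c) = c - a" if "c \<in> unit_disc" for c
      using \<psi> disc_nz[OF that] that by (simp add: Moebius_function_simple)
  qed (use \<open>open U\<close> U(1) that in \<open>auto intro!: holomorphic_intros\<close>)
  have q: "q \<notin> U"
  proof
    assume "q \<in> U"
    from \<psi>_eq[OF this] have "q = a" using a(1) by (simp add: q_def)
    then have "a * cnj a = 1" using a(1) by (simp add: q_def field_simps)
    then have "norm a * norm a = 1" by (metis norm_mult complex_mod_cnj norm_one)
    then show False using a(2) by (metis abs_norm_cancel abs_square_eq_1 less_irrefl power2_eq_square)
  qed
  have Sf: "S f \<in> H" using bS f unfolding bounded_op_def by blast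
  have Sf_w: "S f w = Moebius_function 0 a w * f w" if w: "w \<in> unit_disc" for w
  proof -
    define A where "A = Moebius_function 0 a w"
    define B where "B = - (1 - cnj a * a) / (cnj a * (1 - cnj a * w))"
    (* partial fractions in c, with simple poles at w and at q *)
    have frac: "\<psi> c / (c - w) = A * (1 / (c - w)) + B * (1 / (c - q))"
      if c: "c \<in> U" "c \<noteq> w" for c
    proof -
      have cq: "c - q \<noteq> 0" using c q by auto
      then have nz: "1 - cnj a * c \<noteq> 0" using a(1) by (auto simp: q_def field_simps)
      have "\<psi> c = (c - a) / (1 - cnj a * c)"
        using \<psi>_eq[OF c(1)] nz by (simp add: field_simps)
      moreover have "1 / (c - q) = - cnj a / (1 - cnj a * c)"
        using a(1) nz cq by (simp add: q_def field_simps)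
      moreover have "(c - a) / (1 - cnj a * c) / (c - w)
          = (w - a) / (1 - cnj a * w) * (1 / (c - w))
            + - (1 - cnj a * a) / (cnj a * (1 - cnj a * w)) * (- cnj a / (1 - cnj a * c))"
      proof -
        have "(c - a) * (1 - cnj a * w) = (w - a) * (1 - cnj a * c) + (1 - cnj a * a) * (c - w)"
          by (simp add: algebra_simps)
        then have "(c - a) / (1 - cnj a * c) = (w - a) / (1 - cnj a * w)
            + (1 - cnj a * a) * (c - w) / ((1 - cnj a * w) * (1 - cnj a * c))"
          using nz disc_nz[OF w] by (simp add: divide_simps)
        then show ?thesis
          using a(1) c(2) by (simp add: add_divide_distrib minus_divide_left del: divide_minus_left)
      qed
      ultimately show ?thesis unfolding A_def B_def Moebius_function_simple by simp
    qed
    have int: "contour_integral p (\<lambda>c. \<psi> c * ip (resolvent H mult_z c f) (kernel_at w))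
        = 2 * of_real pi * \<i> * f w * (A * winding_number p w + B * winding_number p q)"
      if p: "p \<in> set \<Gamma>" for p
    proof -
      have vp: "valid_path p" and im: "path_image p \<subseteq> U - op_spectrum H ip mult_z"
        using \<Gamma> p by auto
      have wp: "w \<notin> path_image p" and qp: "q \<notin> path_image p"
        using im disc_subset_spectrum w q by auto
      have "contour_integral p (\<lambda>c. \<psi> c * ip (resolvent H mult_z c f) (kernel_at w))
          = contour_integral p (\<lambda>c. f w * (A * (1 / (c - w)) + B * (1 / (c - q))))"
      proof (rule contour_integral_eq)
        fix c assume c: "c \<in> path_image p"
        then have cU: "c \<in> U" "c \<noteq> w" and cs: "c \<notin> op_spectrum H ip mult_z"
          using im wp by auto
        note R = resolvent_apply[OF cs f]
        have "ip (resolvent H mult_z c f) (kernel_at w) = f w / (c - w)"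
          unfolding ip_kernel_at[OF R(1) w] using R(2)[of w] cU(2) by (simp add: field_simps)
        then show "\<psi> c * ip (resolvent H mult_z c f) (kernel_at w)
            = f w * (A * (1 / (c - w)) + B * (1 / (c - q)))"
          using frac[OF cU] by (metis mult.commute times_divide_eq_right)
      qed
      also have "\<dots> = f w * (A * (2 * of_real pi * \<i> * winding_number p w)
                            + B * (2 * of_real pi * \<i> * winding_number p q))"
        by (intro contour_integral_unique has_contour_integral_lmul has_contour_integral_add)
          (use has_contour_integral_winding_number[OF vp wp]
             has_contour_integral_winding_number[OF vp qp] in simp_all)
      finally show ?thesis by (simp add: algebra_simps)
    qed
    have "S f w = ip (S f) (kernel_at w)"
      by (rule ip_kernel_at[OF Sf w, symmetric])
    also have "\<dots> = 1 / (2 * of_real pi * \<i>) *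
        (\<Sum>p\<leftarrow>\<Gamma>. 2 * of_real pi * \<i> * f w * (A * winding_number p w + B * winding_number p q))"
      using coeffs f kernel_at_mem[OF w] int by (simp cong: map_cong)
    also have "\<dots> = 1 / (2 * of_real pi * \<i>) * (2 * of_real pi * \<i> * f w *
        (A * (\<Sum>p\<leftarrow>\<Gamma>. winding_number p w) + B * (\<Sum>p\<leftarrow>\<Gamma>. winding_number p q)))"
      by (simp only: sum_list_const_mult sum_list_addf)
    also have "(\<Sum>p\<leftarrow>\<Gamma>. winding_number p w) = 1"
      using wind1 w disc_subset_spectrum by blast
    also have "(\<Sum>p\<leftarrow>\<Gamma>. winding_number p q) = 0"
      using wind0 q by blast
    finally show ?thesis by (simp add: A_def)
  qed
  show "S f = (\<lambda>z. Moebius_function 0 a z * f z)"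
    by (rule H_eqI[OF Sf Sf_w]) (use vanishes[OF f] in auto)
qed

text \<open>
  Let \<open>f\<close> be \<open>\<Sum>n\<le>N. z ^ n / (n + 1)\<close> and \<open>L\<close> the sum of its coefficients. As \<open>\<gamma> \<le> -1\<close>, comparing
  \<open>(n + 1) powr (- \<gamma> - 1)\<close> with its value at \<open>N\<close> shows that \<open>\<parallel>f\<parallel>\<^sup>2\<close> is at most of the order
  \<open>N powr (- \<gamma> - 1) * L\<close>. For the zero \<open>t = 1 - 1 / (4 * N)\<close> the coefficients of the automorphism in
  the degrees from \<open>1\<close> to \<open>2 * N\<close> are all at least \<open>1 / (8 * N)\<close>. In the product, each coefficient
  of degree \<open>m\<close> with \<open>N < m \<le> 2 * N\<close> is therefore at least \<open>L / (8 * N)\<close>, and these \<open>N\<close> coefficients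
  contribute at least the order of \<open>N powr (- \<gamma> - 1) * L\<^sup>2\<close> to the square of the norm.
\<close>

lemma norm_ratio_lower_bound:
  assumes \<gamma>: "\<gamma> \<le> -1"
  shows "\<exists>c>0. \<forall>N\<ge>1. \<exists>f\<in>H. ip_norm ip f > 0 \<and>
    c * harm (Suc N) * (ip_norm ip f)\<^sup>2
      \<le> (ip_norm ip (\<lambda>z. Moebius_function 0 (of_real (1 - 1 / (4 * real N))) z * f z))\<^sup>2"
proof -
  obtain c1 c2 where c12: "c1 > 0" "c2 > 0"
    "\<forall>n. c1 * (real n + 1) powr \<gamma> \<le> b n \<and> b n \<le> c2 * (real n + 1) powr \<gamma>"
    using b_comparable unfolding comparable_def by blast
  then have c: "c1 > 0" "c2 > 0" "c1 * (real n + 1) powr \<gamma> \<le> b n"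
    "b n \<le> c2 * (real n + 1) powr \<gamma>" for n by auto
  have main: "\<exists>f\<in>H. ip_norm ip f > 0 \<and>
    c1 / (64 * c2) * harm (Suc N) * (ip_norm ip f)\<^sup>2
      \<le> (ip_norm ip (\<lambda>z. Moebius_function 0 (of_real (1 - 1 / (4 * real N))) z * f z))\<^sup>2"
    if N: "N \<ge> 1" for N
  proof -
    define L :: real where "L = (\<Sum>n\<le>N. 1 / (real n + 1))"
    have L_harm: "L = harm (Suc N)"
    proof -
      have "harm (Suc N) = (\<Sum>k\<in>Suc ` {..N}. inverse (real k))"
        unfolding harm_def by (simp add: atLeast0AtMost[symmetric] image_Suc_atLeastAtMost)
      then show ?thesis
        by (simp add: L_def sum.reindex inverse_eq_divide add.commute)
    qed
    have L0: "L > 0"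
      unfolding L_def by (intro sum_pos) auto
    define t where "t = 1 - 1 / (4 * real N)"
    have t: "0 < t" "t < 1" using N by (auto simp: t_def field_simps)
    (* Bernoulli's inequality; the denominator 4 * N in t is chosen for this bound *)
    have t_pow: "t ^ j \<ge> 1 / 2" if "j \<le> 2 * N" for j
    proof -
      have "1 / 2 = 1 + real (2 * N) * (t - 1)" using N by (simp add: t_def)
      also have "\<dots> \<le> (1 + (t - 1)) ^ (2 * N)"
        by (rule Bernoulli_inequality) (use t in simp)
      also have "\<dots> \<le> t ^ j"
        using t that by (simp add: power_decreasing)
      finally show ?thesis .
    qed
    have t_sq: "1 - t\<^sup>2 \<ge> 1 / (4 * real N)"
    proof -
      have "t\<^sup>2 \<le> t" using t by (simp add: power2_eq_square mult_left_le)
      then show ?thesis by (simp add: t_def)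
    qed
    define a where "a n = (if n \<le> N then of_real (1 / (real n + 1)) else 0 :: complex)" for n
    have fin: "summable (\<lambda>n. (norm (a n))\<^sup>2 / b n)"
      by (rule summable_finite[of "{..N}"]) (auto simp: a_def)
    obtain f where f: "f \<in> H" "\<forall>n. taylor f n = a n"
      using series_mem[OF fin] by blast
    have f_norm: "(ip_norm ip f)\<^sup>2 = (\<Sum>n\<le>N. (1 / (real n + 1))\<^sup>2 / b n)"
    proof -
      have "(ip_norm ip f)\<^sup>2 = (\<Sum>n. (norm (a n))\<^sup>2 / b n)"
        using sums_unique[OF norm_sums[OF f(1)]] f(2) by simp
      also have "\<dots> = (\<Sum>n\<le>N. (norm (a n))\<^sup>2 / b n)"
        by (rule suminf_finite) (auto simp: a_def)
      also have "\<dots> = (\<Sum>n\<le>N. (1 / (real n + 1))\<^sup>2 / b n)"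
      proof (rule sum.cong)
        fix n assume "n \<in> {..N}"
        then have "norm (a n) = 1 / (real n + 1)"
          unfolding a_def by (simp only: atMost_iff if_True norm_of_real) simp
        then show "(norm (a n))\<^sup>2 / b n = (1 / (real n + 1))\<^sup>2 / b n" by simp
      qed simp
      finally show ?thesis .
    qed
    define P where "P = (real N + 1) powr (- \<gamma> - 1)"
    have P0: "P > 0" by (simp add: P_def)
    have upper: "(ip_norm ip f)\<^sup>2 \<le> P * L / c1"
    proof -
      have "(1 / (real n + 1))\<^sup>2 / b n \<le> P / c1 * (1 / (real n + 1))" if n: "n \<le> N" for n
      proof -
        have "(1 / (real n + 1))\<^sup>2 / b n \<le> (1 / (real n + 1))\<^sup>2 / (c1 * (real n + 1) powr \<gamma>)"
          using c b_pos[of n] by (intro divide_left_mono mult_pos_pos) auto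
        also have "\<dots> = (real n + 1) powr (- \<gamma> - 1) / c1 * (1 / (real n + 1))"
          by (simp add: powr_diff powr_minus power2_eq_square field_simps)
        also have "\<dots> \<le> P / c1 * (1 / (real n + 1))"
          unfolding P_def using \<gamma> n c(1)
          by (intro mult_right_mono divide_right_mono powr_mono2) auto
        finally show ?thesis .
      qed
      then have "(ip_norm ip f)\<^sup>2 \<le> (\<Sum>n\<le>N. P / c1 * (1 / (real n + 1)))"
        unfolding f_norm by (intro sum_mono) auto
      then show ?thesis unfolding L_def sum_distrib_left[symmetric] by simp
    qed
    have pos: "ip_norm ip f > 0"
    proof (rule ip_norm_pos[OF f(1)])
      show "f \<noteq> (\<lambda>x. 0)"
      proof
        assume "f = (\<lambda>x. 0)"
        then have "taylor f 0 = 0" by (simp add: taylor_def)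
        then show False using f(2) by (simp add: a_def)
      qed
    qed
    define w :: complex where "w = of_real t"
    have w: "norm w < 1" "norm w = t" using t by (auto simp: w_def)
    define g where "g = Moebius_coeff 1 w"
    define F where "F = (\<lambda>z. Moebius_function 0 w z * f z)"
    have G_sums: "(\<lambda>k. g k * z ^ k) sums Moebius_function 0 w z" if "z \<in> unit_disc" for z
      unfolding g_def using Moebius_coeff_sums[OF w(1) that, of 1]
      by (simp add: Moebius_function_simple)
    have g_norm: "norm (g k) = Moebius_weight t k" for k
      unfolding g_def using norm_Moebius_coeff[of 1 w k] w by simp
    have g_summable: "summable (\<lambda>k. norm (g k))"
      unfolding g_norm using Moebius_weight_sums[of t] t by (simp add: sums_iff)
    have g_wt: "summable (\<lambda>k. norm (g k) * wt k)"
    proof -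
      have S: "summable (\<lambda>k. (1 - t\<^sup>2) / t * (t ^ k * wt k))"
        using t by (intro summable_mult summable_geometric_wt) auto
      have ev: "\<forall>\<^sub>F k in sequentially. (1 - t\<^sup>2) / t * (t ^ k * wt k) = norm (g k) * wt k"
      proof (rule eventually_sequentiallyI[of 1])
        fix k :: nat assume "1 \<le> k"
        then obtain j where "k = Suc j" by (cases k) auto
        then show "(1 - t\<^sup>2) / t * (t ^ k * wt k) = norm (g k) * wt k"
          using t by (simp add: g_norm Moebius_weight_def)
      qed
      show ?thesis using summable_cong[OF ev] S by simp
    qed
    have F: "F \<in> H" unfolding F_def by (rule mult_mem[OF f(1) G_sums g_wt])
    have F_taylor: "taylor F m = (\<Sum>n\<le>m. g (m - n) * a n)" for m
      unfolding F_def
      by (rule taylor_unique)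
        (use mult_series_sums[OF holomorphic[OF f(1)] G_sums g_summable] f(2) in simp)
    have coeff: "norm (taylor F m) \<ge> L / (8 * real N)" if m: "N < m" "m \<le> 2 * N" for m
    proof -
      have "taylor F m = (\<Sum>n\<le>N. g (m - n) * a n)"
        unfolding F_taylor by (rule sum.mono_neutral_right) (use m in \<open>auto simp: a_def\<close>)
      also have "\<dots> = (\<Sum>n\<le>N. of_real ((1 - t\<^sup>2) * t ^ (m - n - 1) * (1 / (real n + 1))))"
      proof (rule sum.cong)
        fix n assume "n \<in> {..N}"
        then have "n \<le> N" "m - n \<noteq> 0" using m by auto
        then show "g (m - n) * a n = of_real ((1 - t\<^sup>2) * t ^ (m - n - 1) * (1 / (real n + 1)))"
          using t by (simp add: g_def Moebius_coeff_def a_def w_def)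
      qed simp
      also have "\<dots> = of_real (\<Sum>n\<le>N. (1 - t\<^sup>2) * t ^ (m - n - 1) * (1 / (real n + 1)))"
        by (rule of_real_sum[symmetric])
      finally have "norm (taylor F m) = \<bar>\<Sum>n\<le>N. (1 - t\<^sup>2) * t ^ (m - n - 1) * (1 / (real n + 1))\<bar>"
        by (simp only: norm_of_real)
      also have "\<dots> \<ge> (\<Sum>n\<le>N. 1 / (4 * real N) * (1 / 2) * (1 / (real n + 1)))"
      proof (rule order_trans[OF sum_mono abs_ge_self])
        fix n assume "n \<in> {..N}"
        have "1 / (4 * real N) * (1 / 2) \<le> (1 - t\<^sup>2) * t ^ (m - n - 1)"
          using t_sq t_pow[of "m - n - 1"] m t by (intro mult_mono) (auto simp: power_le_one)
        then show "1 / (4 * real N) * (1 / 2) * (1 / (real n + 1))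
            \<le> (1 - t\<^sup>2) * t ^ (m - n - 1) * (1 / (real n + 1))"
          by (rule mult_right_mono) simp
      qed
      also have "(\<Sum>n\<le>N. 1 / (4 * real N) * (1 / 2) * (1 / (real n + 1))) = L / (8 * real N)"
        unfolding L_def sum_distrib_left[symmetric] by simp
      finally show ?thesis .
    qed
    have term_lower: "(L / (8 * real N))\<^sup>2 / (c2 * (real N + 1) powr \<gamma>) \<le> (norm (taylor F m))\<^sup>2 / b m"
      if m: "m \<in> {N<..2 * N}" for m
    proof (rule frac_le)
      show "(L / (8 * real N))\<^sup>2 \<le> (norm (taylor F m))\<^sup>2"
        using coeff[of m] m L0 by (intro power_mono) auto
      have "b m \<le> c2 * (real m + 1) powr \<gamma>" by (rule c(4))
      also have "\<dots> \<le> c2 * (real N + 1) powr \<gamma>"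
        using m \<gamma> c(2) by (intro mult_left_mono powr_mono2') auto
      finally show "b m \<le> c2 * (real N + 1) powr \<gamma>" .
    qed (use b_pos in auto)
    have "L\<^sup>2 * P / (64 * c2) \<le> real N * ((L / (8 * real N))\<^sup>2 / (c2 * (real N + 1) powr \<gamma>))"
    proof -
      define n1 X where "n1 = real N + 1" and "X = n1 powr \<gamma>"
      have "X > 0" "n1 > 0" "P = 1 / (X * n1)"
        by (simp_all add: X_def n1_def P_def powr_diff powr_minus inverse_eq_divide)
      then have "real N * ((L / (8 * real N))\<^sup>2 / (c2 * (real N + 1) powr \<gamma>))
              = L\<^sup>2 * P / (64 * c2) * ((real N + 1) / real N)"
        using N unfolding n1_def[symmetric] X_def[symmetric]
        by (simp add: power2_eq_square)
      moreover have "L\<^sup>2 * P / (64 * c2) * 1 \<le> L\<^sup>2 * P / (64 * c2) * ((real N + 1) / real N)"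
        using P0 c(2) N by (intro mult_left_mono) auto
      ultimately show ?thesis by simp
    qed
    also have "\<dots> = (\<Sum>m\<in>{N<..2 * N}. (L / (8 * real N))\<^sup>2 / (c2 * (real N + 1) powr \<gamma>))"
      by simp
    also have "\<dots> \<le> (\<Sum>m\<in>{N<..2 * N}. (norm (taylor F m))\<^sup>2 / b m)"
      by (rule sum_mono) (rule term_lower)
    also have "\<dots> \<le> (\<Sum>m. (norm (taylor F m))\<^sup>2 / b m)"
      by (rule sum_le_suminf[OF taylor_summable_sq[OF F]]) (use b_pos in \<open>auto simp: less_imp_le\<close>)
    also have "\<dots> = (ip_norm ip F)\<^sup>2"
      using sums_unique[OF norm_sums[OF F]] by simp
    finally have lower: "L\<^sup>2 * P / (64 * c2) \<le> (ip_norm ip F)\<^sup>2" .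
    have "c1 / (64 * c2) * L * (ip_norm ip f)\<^sup>2 \<le> c1 / (64 * c2) * L * (P * L / c1)"
      using c L0 upper by (intro mult_left_mono) auto
    also have "\<dots> = L\<^sup>2 * P / (64 * c2)"
      using c by (simp add: power2_eq_square)
    also note lower
    finally show ?thesis
      using f(1) pos unfolding F_def w_def t_def L_harm by blast
  qed
  have "c1 / (64 * c2) > 0" using c by simp
  with main show ?thesis by blast
qed

lemma not_Moebius_bounded_mult_z:
  assumes \<gamma>: "\<gamma> \<le> -1"
  shows "\<not> Moebius_bounded H ip mult_z"
proof
  assume "Moebius_bounded H ip mult_z"
  then obtain C where C: "\<forall>\<phi>\<in>Moeb. \<exists>S. Moeb_calculus H ip mult_z \<phi> S \<and> op_norm H ip S \<le> C"
    unfolding Moebius_bounded_def by blast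
  obtain c where c: "c > 0" "\<forall>N\<ge>1. \<exists>f\<in>H. ip_norm ip f > 0 \<and>
    c * harm (Suc N) * (ip_norm ip f)\<^sup>2
      \<le> (ip_norm ip (\<lambda>z. Moebius_function 0 (of_real (1 - 1 / (4 * real N))) z * f z))\<^sup>2"
    using norm_ratio_lower_bound[OF \<gamma>] by blast
  have "harm (Suc N) \<le> C\<^sup>2 / c" if N: "N \<ge> 1" for N
  proof -
    define a :: complex where "a = of_real (1 - 1 / (4 * real N))"
    have t: "0 < 1 - 1 / (4 * real N)" "1 - 1 / (4 * real N) < 1"
      using N by (auto simp: field_simps)
    then have a: "a \<noteq> 0" "norm a < 1" unfolding a_def of_real_eq_0_iff norm_of_real by auto
    obtain S where S: "Moeb_calculus H ip mult_z (Moebius_function 0 a) S" "op_norm H ip S \<le> C"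
      using C Moebius_function_in_Moeb[OF a(2)] by blast
    obtain f where f: "f \<in> H" "ip_norm ip f > 0"
      "c * harm (Suc N) * (ip_norm ip f)\<^sup>2 \<le> (ip_norm ip (\<lambda>z. Moebius_function 0 a z * f z))\<^sup>2"
      using c(2) N unfolding a_def by blast
    note unique = Moeb_calculus_unique[OF a S(1) f(1)]
    have "ip_norm ip (\<lambda>z. Moebius_function 0 a z * f z) \<le> C * ip_norm ip f"
      using op_norm_bound[OF unique(1) S(2) f(1)] unfolding unique(2) .
    moreover have "(\<lambda>z. Moebius_function 0 a z * f z) \<in> H"
      using unique f(1) unfolding bounded_op_def by metis
    ultimately have "(ip_norm ip (\<lambda>z. Moebius_function 0 a z * f z))\<^sup>2 \<le> (C * ip_norm ip f)\<^sup>2"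
      by (intro power_mono ip_norm_nonneg)
    with f(3) have "(c * harm (Suc N)) * (ip_norm ip f)\<^sup>2 \<le> C\<^sup>2 * (ip_norm ip f)\<^sup>2"
      by (simp add: power_mult_distrib)
    then have "c * harm (Suc N) \<le> C\<^sup>2"
      using f(2) by (simp add: mult_le_cancel_right)
    then show ?thesis using c(1) by (simp add: field_simps)
  qed
  moreover have "\<exists>N\<ge>1. harm (Suc N) > C\<^sup>2 / c"
  proof -
    have "filterlim (\<lambda>N. harm (Suc N) :: real) at_top sequentially"
      using harm_at_top by (rule filterlim_compose) (rule filterlim_Suc)
    then have "\<forall>\<^sub>F N in sequentially. harm (Suc N) > C\<^sup>2 / c"
      by (simp add: filterlim_at_top_dense)
    then show ?thesis
      by (metis (mono_tags, lifting) eventually_conj eventually_ge_at_top eventually_happens'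
          sequentially_bot)
  qed
  ultimately show False by (meson not_le)
qed

end

section \<open>The characterization\<close>

theorem corollary4p5:
  fixes b :: "nat \<Rightarrow> real" and \<gamma> :: real
  assumes "\<And>n. b n > 0"
    and "positive_definite_kernel unit_disc (power_kernel b)"
    and "comparable b (\<lambda>n. (real n + 1) powr \<gamma>)"
  shows "(\<forall>H ip. disc_rkhs H ip (power_kernel b) \<longrightarrow>
            (Moebius_bounded H ip mult_z \<longleftrightarrow> \<gamma> > -1)) \<and>
         (\<forall>H ip. disc_rkhs H ip Dirichlet_kernel \<longrightarrow>
            \<not> Moebius_bounded H ip mult_z)"
proof (intro conjI allI impI)
  fix H :: "(complex \<Rightarrow> complex) set" and ip
  assume "disc_rkhs H ip (power_kernel b)"
  then interpret power_weight_space H ip b \<gamma>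
    by (rule power_weight_space.intro) (unfold_locales, rule assms(1), rule assms(3))
  show "Moebius_bounded H ip mult_z \<longleftrightarrow> \<gamma> > -1"
    using Moebius_bounded_mult_z not_Moebius_bounded_mult_z by (meson not_le)
next
  fix H :: "(complex \<Rightarrow> complex) set" and ip
  assume "disc_rkhs H ip Dirichlet_kernel"
  then have "disc_rkhs H ip (power_kernel (\<lambda>n. 1 / (real n + 1)))"
    unfolding Dirichlet_kernel_def .
  then interpret power_weight_space H ip "\<lambda>n. 1 / (real n + 1)" "-1"
  proof (rule power_weight_space.intro)
    show "power_weight_space_axioms (\<lambda>n. 1 / (real n + 1)) (-1)"
    proof
      show "comparable (\<lambda>n. 1 / (real n + 1)) (\<lambda>n. (real n + 1) powr (-1))"
        unfolding comparable_def
        by (intro exI[of _ 1] conjI allI) (auto simp: powr_minus inverse_eq_divide)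
    qed simp
  qed
  show "\<not> Moebius_bounded H ip mult_z"
    by (rule not_Moebius_bounded_mult_z) simp
qed

end
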